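(* Every outerplanar graph $G$ has an equitable $t$-tree-coloring for every integer $t\ge 2$; that is, $va^{\equiv}_{\infty,\infty}(G)=2$ if $G$ is not a forest and $va^{\equiv}_{\infty,\infty}(G)=1$ otherwise.
   Context: A graph is outerplanar if it can be drawn in the plane without crossings so that all vertices lie on the outer face. A $t$-coloring of $G$ is a map $f:V(G)\to\{1,\dots,t\}$ (not necessarily surjective) with color classes $V_i=f^{-1}(i)$; it is equitable if $||V_i|-|V_j||\le 1$ for all $i,j$. An equitable $t$-tree-coloring is an equitable $t$-coloring in which every color class induces a forest. $va^{\equiv}_{\infty,\infty}(G)$ is the smallest positive integer $t$ such that $G$ has an equitable $t'$-tree-coloring for every integer $t'\ge t$. *)

theory Defs
  imports "HOL-Analysis.Analysis"
begin

text \<open>A finite simple graph is given by its vertex set \<open>V\<close> and its set \<open>E\<close> of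
  two-element edges.\<close>

definition simple_graph :: "'a set \<Rightarrow> 'a set set \<Rightarrow> bool" where
  "simple_graph V E \<longleftrightarrow> finite V \<and> (\<forall>e\<in>E. e \<subseteq> V \<and> card e = 2)"

text \<open>A cycle is listed by its vertices in cyclic order, without repeating the first one.\<close>

definition is_cycle :: "'a set \<Rightarrow> 'a set set \<Rightarrow> 'a list \<Rightarrow> bool" where
  "is_cycle V E vs \<longleftrightarrow> set vs \<subseteq> V \<and> distinct vs \<and> 3 \<le> length vs \<and>
     (\<forall>i<length vs. {vs ! i, vs ! (Suc i mod length vs)} \<in> E)"

definition forest :: "'a set \<Rightarrow> 'a set set \<Rightarrow> bool" where
  "forest V E \<longleftrightarrow> (\<nexists>vs. is_cycle V E vs)"

definition induced_edges :: "'a set set \<Rightarrow> 'a set \<Rightarrow> 'a set set" where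
  "induced_edges E W = {e \<in> E. e \<subseteq> W}"

text \<open>A drawing without crossings: vertices are distinct points, edges are (not necessarily
  polygonal) arcs joining their end vertices, no edge passes through a further vertex, and two
  edges meet at most in common end vertices.\<close>

definition plane_drawing ::
  "'a set \<Rightarrow> 'a set set \<Rightarrow> ('a \<Rightarrow> complex) \<Rightarrow> ('a set \<Rightarrow> real \<Rightarrow> complex) \<Rightarrow> bool" where
  "plane_drawing V E p \<gamma> \<longleftrightarrow>
     inj_on p V \<and>
     (\<forall>e\<in>E. arc (\<gamma> e) \<and> {pathstart (\<gamma> e), pathfinish (\<gamma> e)} = p ` e \<and>
        path_image (\<gamma> e) \<inter> p ` V = p ` e) \<and>
     (\<forall>e\<in>E. \<forall>e'\<in>E. e \<noteq> e' \<longrightarrow> path_image (\<gamma> e) \<inter> path_image (\<gamma> e') = p ` (e \<inter> e'))"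

definition drawing_points ::
  "'a set \<Rightarrow> 'a set set \<Rightarrow> ('a \<Rightarrow> complex) \<Rightarrow> ('a set \<Rightarrow> real \<Rightarrow> complex) \<Rightarrow> complex set" where
  "drawing_points V E p \<gamma> = p ` V \<union> (\<Union>e\<in>E. path_image (\<gamma> e))"

text \<open>The drawing of a finite graph is bounded, so the complement has exactly one unbounded
  component, the outer face; this is \<^const>\<open>outside\<close>. Faces are open and disjoint from the
  drawing, so a vertex lies on a face when it belongs to the boundary of that face.\<close>

definition outerplanar :: "'a set \<Rightarrow> 'a set set \<Rightarrow> bool" where
  "outerplanar V E \<longleftrightarrow>
     (\<exists>p \<gamma>. plane_drawing V E p \<gamma> \<and> p ` V \<subseteq> frontier (outside (drawing_points V E p \<gamma>)))"

definition color_class :: "'a set \<Rightarrow> ('a \<Rightarrow> nat) \<Rightarrow> nat \<Rightarrow> 'a set" where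
  "color_class V f i = {v \<in> V. f v = i}"

definition coloring :: "'a set \<Rightarrow> nat \<Rightarrow> ('a \<Rightarrow> nat) \<Rightarrow> bool" where
  "coloring V t f \<longleftrightarrow> f ` V \<subseteq> {1..t}"

definition equitable :: "'a set \<Rightarrow> nat \<Rightarrow> ('a \<Rightarrow> nat) \<Rightarrow> bool" where
  "equitable V t f \<longleftrightarrow>
     (\<forall>i\<in>{1..t}. \<forall>j\<in>{1..t}. \<bar>int (card (color_class V f i)) - int (card (color_class V f j))\<bar> \<le> 1)"

definition equitable_tree_coloring :: "'a set \<Rightarrow> 'a set set \<Rightarrow> nat \<Rightarrow> ('a \<Rightarrow> nat) \<Rightarrow> bool" where
  "equitable_tree_coloring V E t f \<longleftrightarrow>
     coloring V t f \<and> equitable V t f \<and>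
     (\<forall>i\<in>{1..t}. forest (color_class V f i) (induced_edges E (color_class V f i)))"

text \<open>For a finite graph the minimum exists: every \<open>t \<ge> max 1 (card V)\<close> has the property, by
  giving distinct colors to all vertices.\<close>

definition va_equiv :: "'a set \<Rightarrow> 'a set set \<Rightarrow> nat" where
  "va_equiv V E = (LEAST t. 1 \<le> t \<and> (\<forall>t'\<ge>t. \<exists>f. equitable_tree_coloring V E t' f))"

end

theory Submission
  imports Defs
begin

text \<open>
  In a plane drawing of three internally disjoint paths with common ends, one path lies inside the
  cycle formed by the other two. If all vertices are on the outer face, such a path has no inner
  vertex. This excludes subdivisions of \<open>K\<^bsub>2,3\<^esub>\<close> and cycles with crossing chords.

  A longest-path argument then shows that every nonempty outerplanar graph has a vertex of degree at
  most 1 or an edge \<open>xy\<close> with \<open>deg x = 2\<close> and \<open>deg y \<le> 4\<close>. Hence one can remove a set \<open>S\<close> of \<open>t\<close>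
  vertices each having at most 3 neighbours outside \<open>S\<close>, and one of them at most 1. Color the rest
  by induction. A vertex of \<open>S\<close> must avoid the colors that appear twice among its neighbours outside
  \<open>S\<close>; there is at most one, and for the exceptional vertex none. So the \<open>t\<close> colors can be
  distributed bijectively over \<open>S\<close>, and every color class gains a vertex of degree at most 1.
\<close>

subsection \<open>Theta curves\<close>

text \<open>Arcs are kept as point sets with two marked ends and the parametrization is hidden, so
  reversing, joining and intersecting them become set operations.\<close>

definition arc_between :: "complex set \<Rightarrow> complex \<Rightarrow> complex \<Rightarrow> bool" where
  "arc_between A a b \<longleftrightarrow> (\<exists>g. arc g \<and> path_image g = A \<and> pathstart g = a \<and> pathfinish g = b)"

lemma arc_between_commute: "arc_between A a b \<Longrightarrow> arc_between A b a"
  unfolding arc_between_def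
  by (metis arc_reversepath path_image_reversepath pathfinish_reversepath pathstart_reversepath)

lemma arc_between_ends: "arc_between A a b \<Longrightarrow> a \<in> A \<and> b \<in> A \<and> a \<noteq> b"
  unfolding arc_between_def using arc_distinct_ends by fastforce

lemma compact_arc_between: "arc_between A a b \<Longrightarrow> compact A"
  unfolding arc_between_def using compact_arc_image by blast

lemma connected_arc_between: "arc_between A a b \<Longrightarrow> connected A"
  unfolding arc_between_def using connected_arc_image by blast

lemma connected_arc_between_open: "arc_between A a b \<Longrightarrow> connected (A - {a, b})"
  unfolding arc_between_def using connected_simple_path_endless arc_imp_simple_path by blast

lemma arc_between_open_nonempty: "arc_between A a b \<Longrightarrow> A - {a, b} \<noteq> {}"
  unfolding arc_between_def using nonempty_simple_path_endless arc_imp_simple_path by blast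

lemma arc_between_join:
  assumes "arc_between A a b" "arc_between B b c" "A \<inter> B = {b}"
  shows "arc_between (A \<union> B) a c"
proof -
  obtain g h where g: "arc g" "path_image g = A" "pathstart g = a" "pathfinish g = b"
    and h: "arc h" "path_image h = B" "pathstart h = b" "pathfinish h = c"
    using assms unfolding arc_between_def by blast
  have "arc (g +++ h)"
    using g h assms by (intro arc_join) auto
  then show ?thesis
    unfolding arc_between_def using g h by (intro exI[of _ "g +++ h"]) (auto simp: path_image_join)
qed

text \<open>Running through one arc and back along the other gives a simple closed curve, to which
  the Jordan curve theorem applies.\<close>

lemma Jordan_arcs:
  assumes "arc_between A a b" "arc_between B a b" "A \<inter> B = {a, b}"
  shows "inside (A \<union> B) \<noteq> {}" "connected (inside (A \<union> B))" "connected (outside (A \<union> B))"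
    "frontier (inside (A \<union> B)) = A \<union> B"
proof -
  obtain g h where g: "arc g" "path_image g = A" "pathstart g = a" "pathfinish g = b"
    and h: "arc h" "path_image h = B" "pathstart h = b" "pathfinish h = a"
    using assms(1) arc_between_commute[OF assms(2)] unfolding arc_between_def by blast
  have "simple_path (g +++ h)"
    using g h assms by (intro simple_path_join_loop) auto
  moreover have "path_image (g +++ h) = A \<union> B" "pathfinish (g +++ h) = pathstart (g +++ h)"
    using g h by (auto simp: path_image_join)
  ultimately show "inside (A \<union> B) \<noteq> {}" "connected (inside (A \<union> B))" "connected (outside (A \<union> B))"
    "frontier (inside (A \<union> B)) = A \<union> B"
    using Jordan_inside_outside[of "g +++ h"] by auto
qed

text \<open>The set \<open>inside J\<close> is a union of components of the complement of
  \<open>J\<close>, and a connected set that avoids \<open>J\<close> stays in one component.\<close>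

lemma connected_subset_inside:
  fixes S J :: "complex set"
  assumes "connected S" "S \<inter> J = {}" "S \<inter> inside J \<noteq> {}"
  shows "S \<subseteq> inside J"
proof
  fix y assume "y \<in> S"
  obtain x where "x \<in> S" "x \<in> inside J" using assms by blast
  then have "connected_component (- J) x y"
    unfolding connected_component_def using assms \<open>y \<in> S\<close> by (intro exI[of _ S]) auto
  then show "y \<in> inside J"
    using inside_same_component \<open>x \<in> inside J\<close> by blast
qed

text \<open>Janiszewski's theorem applies to \<open>A \<union> B\<close> and \<open>B \<union> C\<close>, since they meet in the connected set \<open>B\<close>.\<close>

lemma inside_subset_inside_Un_inside:
  assumes "arc_between A a b" "arc_between B a b" "arc_between C a b"
    and "A \<inter> B = {a, b}" "A \<inter> C = {a, b}" "B \<inter> C = {a, b}"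
  shows "inside (A \<union> C) \<subseteq> inside (A \<union> B) \<union> inside (B \<union> C) \<union> B"
proof (rule ccontr)
  assume "\<not> ?thesis"
  then obtain x where x: "x \<in> inside (A \<union> C)" "x \<notin> inside (A \<union> B)" "x \<notin> inside (B \<union> C)" "x \<notin> B"
    by blast
  have "x \<notin> A \<union> C" using x(1) inside_no_overlap by blast
  then have xo: "x \<in> outside (A \<union> B)" "x \<in> outside (B \<union> C)"
    using x by (auto simp: outside_inside)
  have cpt: "compact A" "compact B" "compact C"
    using assms compact_arc_between by auto
  then have "outside ((A \<union> B) \<union> (B \<union> C)) \<noteq> {}"
    by (intro outside_bounded_nonempty) (auto intro: compact_imp_bounded)
  \<comment> \<open>\<open>y\<close> is a reference point of the unbounded component. Neither of the
    two cycles through \<open>B\<close> separates \<open>x\<close> from it, so by Janiszewski's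
    theorem their union does not either.\<close>
  then obtain y where y: "y \<in> outside ((A \<union> B) \<union> (B \<union> C))" by blast
  have yo: "y \<in> outside (A \<union> B)" "y \<in> outside (B \<union> C)"
    using y outside_mono by (metis Un_upper1 subsetD, metis Un_upper2 subsetD)
  have "connected_component (- (A \<union> B)) y x"
    unfolding connected_component_def using xo yo Jordan_arcs(3)[OF assms(1,2,4)]
    by (metis outside_no_overlap disjoint_eq_subset_Compl)
  moreover have "connected_component (- (B \<union> C)) y x"
    unfolding connected_component_def using xo yo Jordan_arcs(3)[OF assms(2,3,6)]
    by (metis outside_no_overlap disjoint_eq_subset_Compl)
  moreover have "connected ((A \<union> B) \<inter> (B \<union> C))"
  proof -
    have "(A \<union> B) \<inter> (B \<union> C) = B"
      using assms(4-6) by blast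
    then show ?thesis using connected_arc_between assms(2) by metis
  qed
  ultimately have "connected_component (- ((A \<union> B) \<union> (B \<union> C))) y x"
    using Janiszewski[of "A \<union> B" "B \<union> C" y x] cpt compact_Un compact_imp_closed by blast
  then have "x \<in> outside ((A \<union> B) \<union> (B \<union> C))"
    using outside_same_component y by blast
  then have "x \<in> outside (A \<union> C)"
    using outside_mono[of "A \<union> C" "(A \<union> B) \<union> (B \<union> C)"] by blast
  then show False
    using x(1) inside_Int_outside by blast
qed

text \<open>Otherwise no arc meets the region bounded by the other two. Near a point of \<open>A\<close>, the region of
  \<open>A \<union> C\<close> then contains points of the region of \<open>A \<union> B\<close>, so the two regions and hence their
  boundaries coincide.\<close>

lemma theta_curve_inside:
  assumes arcs: "arc_between A a b" "arc_between B a b" "arc_between C a b"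
    and meet: "A \<inter> B = {a, b}" "A \<inter> C = {a, b}" "B \<inter> C = {a, b}"
  shows "A - {a, b} \<subseteq> inside (B \<union> C) \<or> B - {a, b} \<subseteq> inside (A \<union> C) \<or> C - {a, b} \<subseteq> inside (A \<union> B)"
proof (rule ccontr)
  assume neg: "\<not> ?thesis"
  \<comment> \<open>An open arc that met the region of the other two would lie in it entirely, which
    \<open>neg\<close> excludes; its ends lie on the cycle itself. The same holds for
    \<open>B\<close> and \<open>C\<close>.\<close>
  have A: "A \<inter> inside (B \<union> C) = {}"
  proof -
    have "(A - {a, b}) \<inter> inside (B \<union> C) = {}"
      using connected_subset_inside[OF connected_arc_between_open[OF arcs(1)], of "B \<union> C"] neg meet by blast
    moreover have "{a, b} \<inter> inside (B \<union> C) = {}"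
      using meet inside_no_overlap[of "B \<union> C"] by blast
    ultimately show ?thesis by blast
  qed
  have B: "B \<inter> inside (A \<union> C) = {}"
  proof -
    have "(B - {a, b}) \<inter> inside (A \<union> C) = {}"
      using connected_subset_inside[OF connected_arc_between_open[OF arcs(2)], of "A \<union> C"] neg meet by blast
    moreover have "{a, b} \<inter> inside (A \<union> C) = {}"
      using meet inside_no_overlap[of "A \<union> C"] by blast
    ultimately show ?thesis by blast
  qed
  have C: "C \<inter> inside (A \<union> B) = {}"
  proof -
    have "(C - {a, b}) \<inter> inside (A \<union> B) = {}"
      using connected_subset_inside[OF connected_arc_between_open[OF arcs(3)], of "A \<union> B"] neg meet by blast
    moreover have "{a, b} \<inter> inside (A \<union> B) = {}"
      using meet inside_no_overlap[of "A \<union> B"] by blast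
    ultimately show ?thesis by blast
  qed
  obtain q where q: "q \<in> A - {a, b}"
    using arc_between_open_nonempty[OF arcs(1)] by blast
  have "q \<in> outside (B \<union> C)"
    using q A meet by (auto simp: outside_inside)
  moreover have "open (outside (B \<union> C))"
    using compact_arc_between arcs by (metis open_outside compact_Un compact_imp_closed)
  moreover have "q \<in> closure (inside (A \<union> C))"
    using Jordan_arcs(4)[OF arcs(1,3) meet(2)] q by (auto simp: frontier_def)
  ultimately obtain x where x: "x \<in> inside (A \<union> C)" "x \<in> outside (B \<union> C)"
    by (meson disjoint_iff open_Int_closure_eq_empty)
  \<comment> \<open>\<open>x\<close> is not on \<open>B\<close>, which avoids the region of
    \<open>A \<union> C\<close>, and not in the region of \<open>B \<union> C\<close>. Only the
    region of \<open>A \<union> B\<close> is left.\<close>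
  then have "x \<in> inside (A \<union> B)"
    using inside_subset_inside_Un_inside[OF arcs meet] B inside_Int_outside[of "B \<union> C"] by blast
  have "inside (A \<union> B) \<subseteq> inside (A \<union> C)"
    using connected_subset_inside[OF Jordan_arcs(2)[OF arcs(1,2) meet(1)], of "A \<union> C"]
      C inside_no_overlap[of "A \<union> B"] x \<open>x \<in> inside (A \<union> B)\<close> by blast
  moreover have "inside (A \<union> C) \<subseteq> inside (A \<union> B)"
    using connected_subset_inside[OF Jordan_arcs(2)[OF arcs(1,3) meet(2)], of "A \<union> B"]
      B inside_no_overlap[of "A \<union> C"] x \<open>x \<in> inside (A \<union> B)\<close> by blast
  ultimately have "inside (A \<union> B) = inside (A \<union> C)" by (rule equalityI)
  then have "A \<union> B = A \<union> C"
    using Jordan_arcs(4)[OF arcs(1,2) meet(1)] Jordan_arcs(4)[OF arcs(1,3) meet(2)] by argo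
  then show False
    using arc_between_open_nonempty[OF arcs(2)] meet by blast
qed

section \<open>Chords of a closed curve\<close>

lemma arc_between_subset_closure:
  assumes "arc_between A a b" shows "A \<subseteq> closure (A - {a, b})"
proof -
  obtain g where g: "arc g" "path_image g = A" "pathstart g = a" "pathfinish g = b"
    using assms unfolding arc_between_def by blast
  have "g ` closure {0<..<1} \<subseteq> closure (g ` {0<..<1})"
  proof (rule image_closure_subset)
    show "continuous_on (closure {0<..<1}) g"
      using g by (simp add: arc_def path_def)
    show "g ` {0<..<1} \<subseteq> closure (g ` {0<..<1})" by (rule closure_subset)
  qed simp
  then show ?thesis
    using g simple_path_endless[OF arc_imp_simple_path[OF g(1)]] by (simp add: path_image_def)
qed

lemma inside_theta_curve:
  assumes arcs: "arc_between A a b" "arc_between B a b" "arc_between C a b"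
    and meet: "A \<inter> B = {a, b}" "A \<inter> C = {a, b}" "B \<inter> C = {a, b}"
    and C: "C - {a, b} \<subseteq> inside (A \<union> B)"
  shows "inside (A \<union> B) = inside (A \<union> C) \<union> inside (B \<union> C) \<union> (C - {a, b})"
proof -
  obtain g where g: "arc g" "path_image g = A" "pathstart g = a" "pathfinish g = b"
    using arcs unfolding arc_between_def by blast
  obtain h where h: "arc h" "path_image h = B" "pathstart h = a" "pathfinish h = b"
    using arcs unfolding arc_between_def by blast
  obtain k where k: "arc k" "path_image k = C" "pathstart k = a" "pathfinish k = b"
    using arcs unfolding arc_between_def by blast
  note sp = arc_imp_simple_path[OF g(1)] arc_imp_simple_path[OF h(1)] arc_imp_simple_path[OF k(1)]
  have ne: "C \<inter> inside (A \<union> B) \<noteq> {}"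
    using C arc_between_open_nonempty[OF arcs(3)] by blast
  have "a \<noteq> b" using arc_between_ends[OF arcs(1)] by blast
  show ?thesis
    by (rule split_inside_simple_closed_curve[OF sp(1) g(3,4) sp(2) h(3,4) sp(3) k(3,4) \<open>a \<noteq> b\<close>,
        unfolded g h k, OF meet ne]) (rule sym)
qed

text \<open>The chord \<open>P\<close> cuts the region into two, and the open chord \<open>Q\<close>
  misses \<open>P\<close>, so it would lie in one of them and both its ends in the closure of that
  part. But \<open>c\<close> is neither on nor inside \<open>B \<union> P\<close>, and
  \<open>d\<close> is neither on nor inside \<open>A \<union> P\<close>.\<close>

lemma no_crossing_chords_inside:
  assumes arcs: "arc_between A a b" "arc_between B a b" "arc_between P a b" "arc_between Q c d"
    and meet: "A \<inter> B = {a, b}" "A \<inter> P = {a, b}" "B \<inter> P = {a, b}"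
      "Q \<inter> A = {c}" "Q \<inter> B = {d}" "Q \<inter> P = {}"
    and chords: "P - {a, b} \<subseteq> inside (A \<union> B)" "Q - {c, d} \<subseteq> inside (A \<union> B)"
    and outer: "c \<notin> inside (B \<union> P)" "d \<notin> inside (A \<union> P)"
  shows False
proof -
  have ends: "c \<in> Q" "d \<in> Q" "c \<noteq> d" using arc_between_ends[OF arcs(4)] by auto
  have not_inside: "(Q - {c, d}) \<inter> inside J = {}"
    if "closed J" "(Q - {c, d}) \<inter> J = {}" "x \<in> Q" "x \<notin> J" "x \<notin> inside J" for J x
  proof (rule ccontr)
    assume "(Q - {c, d}) \<inter> inside J \<noteq> {}"
    then have "Q - {c, d} \<subseteq> inside J"
      using connected_subset_inside[OF connected_arc_between_open[OF arcs(4)] that(2)] by simp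
    then have "closure (Q - {c, d}) \<subseteq> closure (inside J)" by (rule closure_mono)
    then have "x \<in> closure (inside J)"
      using arc_between_subset_closure[OF arcs(4)] that(3) by blast
    then show False
      using closure_inside_subset[OF that(1)] that(4,5) by blast
  qed
  have closed: "closed (A \<union> P)" "closed (B \<union> P)"
    using arcs[THEN compact_arc_between] by (auto intro!: closed_Un compact_imp_closed)
  have disj: "(Q - {c, d}) \<inter> (A \<union> P) = {}" "(Q - {c, d}) \<inter> (B \<union> P) = {}"
    using meet(4-6) by blast+
  have "d \<notin> A" "d \<notin> P" "c \<notin> B" "c \<notin> P" using meet(4-6) ends by fastforce+
  then have "(Q - {c, d}) \<inter> inside (A \<union> P) = {}" "(Q - {c, d}) \<inter> inside (B \<union> P) = {}"
    using not_inside[OF closed(1) disj(1) ends(2)] not_inside[OF closed(2) disj(2) ends(1)] outer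
    by simp_all
  moreover have "Q - {c, d} \<subseteq> inside (A \<union> P) \<union> inside (B \<union> P)"
    using inside_theta_curve[OF arcs(1-3) meet(1-3) chords(1)] chords(2) meet(6) by blast
  ultimately show False
    using arc_between_open_nonempty[OF arcs(4)] by blast
qed

subsection \<open>Paths in outerplane drawings\<close>

definition nbhd :: "'a set set \<Rightarrow> 'a \<Rightarrow> 'a set" where
  "nbhd E x = {y. {x, y} \<in> E}"

text \<open>The vertex set and the edge set are indices because internal disjointness and the drawn
  curve depend on these sets alone. A path has at least one edge, so its ends differ.\<close>

inductive graph_path :: "'a set set \<Rightarrow> 'a \<Rightarrow> 'a \<Rightarrow> 'a set \<Rightarrow> 'a set set \<Rightarrow> bool" for E where
  edge: "{x, y} \<in> E \<Longrightarrow> x \<noteq> y \<Longrightarrow> graph_path E x y {x, y} {{x, y}}"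
| step: "{x, z} \<in> E \<Longrightarrow> graph_path E z y W F \<Longrightarrow> x \<notin> W \<Longrightarrow>
    graph_path E x y (insert x W) (insert {x, z} F)"

lemma graph_path_ends: "graph_path E x y W F \<Longrightarrow> x \<in> W \<and> y \<in> W \<and> x \<noteq> y"
  by (induction rule: graph_path.induct) auto

lemma graph_path_Union: "graph_path E x y W F \<Longrightarrow> \<Union>F = W"
  by (induction rule: graph_path.induct) (auto dest: graph_path_ends)

lemma graph_path_edges: "graph_path E x y W F \<Longrightarrow> F \<subseteq> E"
  by (induction rule: graph_path.induct) auto

lemma graph_path_change_edges: "graph_path E x y W F \<Longrightarrow> F \<subseteq> E' \<Longrightarrow> graph_path E' x y W F"
  by (induction rule: graph_path.induct) (auto intro: graph_path.intros)

text \<open>A path with several edges leaves \<open>x\<close> by its first edge only, and that edge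
  does not end in \<open>y\<close>.\<close>

lemma graph_path_direct_edge:
  assumes "graph_path E x y W F" "{x, y} \<in> F" shows "W = {x, y}"
  using assms
proof cases
  case (step z W' F')
  then show ?thesis
    using graph_path_ends[of E z y W' F'] graph_path_Union[of E z y W' F'] assms(2)
    by (auto simp: doubleton_eq_iff)
qed auto

lemma graph_path_append:
  "graph_path E x y W F \<Longrightarrow> graph_path E y z W' F' \<Longrightarrow> W \<inter> W' = {y} \<Longrightarrow>
    graph_path E x z (W \<union> W') (F \<union> F')"
proof (induction rule: graph_path.induct)
  case (edge x y)
  then have "graph_path E x z (insert x W') (insert {x, y} F')"
    by (intro graph_path.step) auto
  moreover have "insert x W' = {x, y} \<union> W'" using edge by auto
  ultimately show ?case by simp
next
  case (step x u y W F)
  then have "W \<inter> W' = {y}" "x \<notin> W \<union> W'"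
    using graph_path_ends by fastforce+
  then show ?case
    using step graph_path.step[of x u E z "W \<union> W'" "F \<union> F'"] by simp
qed

lemma graph_path_reverse: "graph_path E x y W F \<Longrightarrow> graph_path E y x W F"
proof (induction rule: graph_path.induct)
  case (edge x y)
  then show ?case using graph_path.edge[of y x E] by (simp add: insert_commute)
next
  case (step x z y W F)
  have "x \<noteq> z" using step graph_path_ends by metis
  then have "graph_path E z x {z, x} {{z, x}}"
    using step by (intro graph_path.edge) (auto simp: insert_commute)
  then have "graph_path E y x (W \<union> {z, x}) (F \<union> {{z, x}})"
    using step graph_path_ends[OF step(2)] by (intro graph_path_append) auto
  moreover have "W \<union> {z, x} = insert x W" using graph_path_ends[OF step(2)] by auto
  ultimately show ?case by (simp add: insert_commute)
qed

lemma graph_path_two_edges: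
  assumes "{x, z} \<in> E" "{z, y} \<in> E" "x \<noteq> y" "x \<noteq> z" "z \<noteq> y"
  shows "graph_path E x y {x, z, y} {{x, z}, {z, y}}"
proof (rule graph_path.step)
  show "graph_path E z y {z, y} {{z, y}}" using assms by (intro graph_path.edge)
qed (use assms in auto)

lemma graph_path_interval:
  assumes "inj_on v {i..j}" "\<And>k. i \<le> k \<Longrightarrow> k < j \<Longrightarrow> {v k, v (Suc k)} \<in> E" "i < j"
  shows "graph_path E (v i) (v j) (v ` {i..j}) ((\<lambda>k. {v k, v (Suc k)}) ` {i..<j})"
  using \<open>i < j\<close> assms(1,2)
proof (induction rule: strict_inc_induct)
  case (base i)
  have "v i \<noteq> v (Suc i)" using inj_onD[OF base.prems(1), of i "Suc i"] base by auto
  moreover have "{i..j} = {i, Suc i}" "{i..<j} = {i}" using base by auto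
  ultimately show ?case using base graph_path.edge[of "v i" "v (Suc i)" E] by auto
next
  case (step i)
  have "v i \<notin> v ` {Suc i..j}"
    using inj_onD[OF step.prems(1), of i] step.hyps by fastforce
  moreover have "graph_path E (v (Suc i)) (v j) (v ` {Suc i..j}) ((\<lambda>k. {v k, v (Suc k)}) ` {Suc i..<j})"
    using step by (intro step.IH) (auto intro: inj_on_subset)
  ultimately have "graph_path E (v i) (v j) (insert (v i) (v ` {Suc i..j}))
      (insert {v i, v (Suc i)} ((\<lambda>k. {v k, v (Suc k)}) ` {Suc i..<j}))"
    using step by (intro graph_path.step) auto
  moreover have "{i..j} = insert i {Suc i..j}" "{i..<j} = insert i {Suc i..<j}" using step.hyps by auto
  ultimately show ?case by simp
qed

section \<open>Curves traced by paths in a drawing with all vertices on the outer face\<close>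

locale outerplane_drawing =
  fixes V :: "'a set" and E :: "'a set set" and p :: "'a \<Rightarrow> complex" and \<gamma> :: "'a set \<Rightarrow> real \<Rightarrow> complex"
  assumes simple: "simple_graph V E"
    and plane: "plane_drawing V E p \<gamma>"
    and outer: "p ` V \<subseteq> frontier (outside (drawing_points V E p \<gamma>))"
begin

definition trace :: "'a set set \<Rightarrow> complex set" where
  "trace F = (\<Union>e\<in>F. path_image (\<gamma> e))"

lemma trace_Un: "trace (F \<union> F') = trace F \<union> trace F'"
  by (auto simp: trace_def)

lemma edge_subset: "e \<in> E \<Longrightarrow> e \<subseteq> V" and edge_card: "e \<in> E \<Longrightarrow> card e = 2"
  using simple by (auto simp: simple_graph_def)

lemma vertices_in_trace: "F \<subseteq> E \<Longrightarrow> p ` \<Union>F \<subseteq> trace F"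
  using plane unfolding plane_drawing_def trace_def by fastforce

text \<open>Distinct edges meet only in common end vertices. This turns questions about intersecting
  curves into questions about vertex sets.\<close>

lemma trace_Int:
  assumes "F \<subseteq> E" "F' \<subseteq> E" "F \<inter> F' = {}"
  shows "trace F \<inter> trace F' = p ` (\<Union>F \<inter> \<Union>F')"
proof -
  have *: "path_image (\<gamma> e) \<inter> path_image (\<gamma> e') = p ` (e \<inter> e')" if "e \<in> F" "e' \<in> F'" for e e'
  proof -
    have "e \<in> E" "e' \<in> E" "e \<noteq> e'" using that assms by auto
    then show ?thesis using plane unfolding plane_drawing_def by blast
  qed
  then have "trace F \<inter> trace F' = (\<Union>e\<in>F. \<Union>e'\<in>F'. p ` (e \<inter> e'))"
    unfolding trace_def by (simp add: Int_UN_distrib2 *)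
  also have "\<dots> = p ` (\<Union>F \<inter> \<Union>F')" by blast
  finally show ?thesis .
qed

lemma graph_path_subset: "graph_path E x y W F \<Longrightarrow> W \<subseteq> V"
  using graph_path_Union graph_path_edges edge_subset by fastforce

lemma trace_graph_path: "graph_path E x y W F \<Longrightarrow> arc_between (trace F) (p x) (p y)"
proof (induction rule: graph_path.induct)
  case (edge x y)
  let ?g = "\<gamma> {x, y}"
  have "arc ?g" "{pathstart ?g, pathfinish ?g} = {p x, p y}"
    using edge plane unfolding plane_drawing_def by fastforce+
  \<comment> \<open>The drawing prescribes no direction for the arc of an edge, so both have to be
    considered.\<close>
  then have "arc_between (path_image ?g) (p x) (p y) \<or> arc_between (path_image ?g) (p y) (p x)"
    unfolding arc_between_def doubleton_eq_iff by blast
  then show ?case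
    using arc_between_commute by (auto simp: trace_def)
next
  case (step x z y W F)
  let ?g = "\<gamma> {x, z}"
  have "arc ?g" "{pathstart ?g, pathfinish ?g} = {p x, p z}"
    using step plane unfolding plane_drawing_def by fastforce+
  then have "arc_between (path_image ?g) (p x) (p z) \<or> arc_between (path_image ?g) (p z) (p x)"
    unfolding arc_between_def doubleton_eq_iff by blast
  then have "arc_between (trace {{x, z}}) (p x) (p z)"
    using arc_between_commute by (auto simp: trace_def)
  moreover have "trace {{x, z}} \<inter> trace F = {p z}"
  proof -
    have W: "\<Union>F = W" "z \<in> W" using step graph_path_Union graph_path_ends by metis+
    then have "{{x, z}} \<inter> F = {}" using step by blast
    then have "trace {{x, z}} \<inter> trace F = p ` ({x, z} \<inter> W)"
      using trace_Int[of "{{x, z}}" F] W step graph_path_edges by fastforce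
    then show ?thesis using W step by auto
  qed
  ultimately show ?case
    using arc_between_join[of "trace {{x, z}}" "p x" "p z" "trace F" "p y"] step
    by (simp add: trace_def)
qed

lemma trace_subset_drawing: "F \<subseteq> E \<Longrightarrow> trace F \<subseteq> drawing_points V E p \<gamma>"
  by (auto simp: trace_def drawing_points_def)

text \<open>Points of the outer face accumulate at every vertex, while \<open>inside J\<close> is
  open and the outer face of the whole drawing lies outside \<open>J\<close>.\<close>

lemma vertex_not_inside:
  assumes "v \<in> V" "closed J" "J \<subseteq> drawing_points V E p \<gamma>"
  shows "p v \<notin> inside J"
proof
  assume "p v \<in> inside J"
  moreover have "p v \<in> closure (outside (drawing_points V E p \<gamma>))"
    using outer assms(1) by (auto simp: frontier_def)
  moreover have "open (inside J)" using assms(2) open_inside by blast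
  ultimately have "inside J \<inter> outside (drawing_points V E p \<gamma>) \<noteq> {}"
    using open_Int_closure_eq_empty by blast
  then show False
    using outside_mono[OF assms(3)] inside_Int_outside by blast
qed

text \<open>Both ends of a common edge are common vertices, so the edge joins \<open>x\<close> to
  \<open>y\<close> directly and the first path would consist of it alone.\<close>

lemma graph_path_edge_disjoint:
  assumes "graph_path E x y W F" "graph_path E x y W' F'" "W \<inter> W' = {x, y}" "W \<noteq> {x, y}"
  shows "F \<inter> F' = {}"
proof (rule ccontr)
  assume "F \<inter> F' \<noteq> {}"
  then obtain e where e: "e \<in> F" "e \<in> F'" by blast
  then have "e \<subseteq> W \<inter> W'"
    using graph_path_Union[OF assms(1)] graph_path_Union[OF assms(2)] by blast
  moreover have "card e = 2" using e(1) graph_path_edges[OF assms(1)] edge_card by blast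
  ultimately have "e = {x, y}"
    using assms(3) graph_path_ends[OF assms(1)] by (intro card_seteq) auto
  then show False using graph_path_direct_edge[OF assms(1)] e assms(4) by blast
qed

lemma closed_trace_paths:
  assumes "graph_path E x y W F" "graph_path E x' y' W' F'" shows "closed (trace F \<union> trace F')"
  using assms trace_graph_path compact_arc_between by (metis compact_Un compact_imp_closed)

text \<open>The first path has an inner vertex, which the other two paths cannot enclose since it is
  on the outer face.\<close>

lemma path_not_inside:
  assumes "graph_path E x y W F" "graph_path E x y W' F'" "graph_path E x y W'' F''"
    and "W \<noteq> {x, y}"
  shows "\<not> trace F - {p x, p y} \<subseteq> inside (trace F' \<union> trace F'')"
proof -
  obtain u where u: "u \<in> W" "u \<noteq> x" "u \<noteq> y" using assms(4) graph_path_ends[OF assms(1)] by blast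
  have "p u \<in> p ` \<Union>F" using u graph_path_Union[OF assms(1)] by blast
  then have "p u \<in> trace F"
    using vertices_in_trace[OF graph_path_edges[OF assms(1)]] by blast
  moreover have V: "u \<in> V" "x \<in> V" "y \<in> V"
    using u graph_path_subset[OF assms(1)] graph_path_ends[OF assms(1)] by auto
  then have "p u \<noteq> p x" "p u \<noteq> p y"
    using u plane unfolding plane_drawing_def by (meson inj_on_contraD)+
  moreover have "p u \<notin> inside (trace F' \<union> trace F'')"
    using closed_trace_paths[OF assms(2,3)] trace_subset_drawing[OF graph_path_edges[OF assms(2)]]
      trace_subset_drawing[OF graph_path_edges[OF assms(3)]]
    by (intro vertex_not_inside V) auto
  ultimately show ?thesis by blast
qed

text \<open>One of the three paths is enclosed by the other two, and the first two cannot be, having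
  inner vertices. The third may be a single edge; that case places the chords of a cycle inside
  it.\<close>

lemma third_path_inside:
  assumes paths: "graph_path E x y W F" "graph_path E x y W' F'" "graph_path E x y W'' F''"
    and meet: "W \<inter> W' = {x, y}" "W \<inter> W'' = {x, y}" "W' \<inter> W'' = {x, y}"
    and ne: "W \<noteq> {x, y}" "W' \<noteq> {x, y}"
  shows "trace F \<inter> trace F' = {p x, p y}" "trace F \<inter> trace F'' = {p x, p y}"
    "trace F' \<inter> trace F'' = {p x, p y}" "trace F'' - {p x, p y} \<subseteq> inside (trace F \<union> trace F')"
proof -
  have "F \<inter> F' = {}" "F \<inter> F'' = {}" "F' \<inter> F'' = {}"
    using graph_path_edge_disjoint[OF paths(1,2) meet(1) ne(1)]
      graph_path_edge_disjoint[OF paths(1,3) meet(2) ne(1)]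
      graph_path_edge_disjoint[OF paths(2,3) meet(3) ne(2)] by auto
  then show 1: "trace F \<inter> trace F' = {p x, p y}" "trace F \<inter> trace F'' = {p x, p y}"
    "trace F' \<inter> trace F'' = {p x, p y}"
    using paths[THEN graph_path_edges] paths[THEN graph_path_Union] meet by (auto simp: trace_Int)
  show "trace F'' - {p x, p y} \<subseteq> inside (trace F \<union> trace F')"
    using theta_curve_inside[OF paths[THEN trace_graph_path] 1]
      path_not_inside[OF paths ne(1)] path_not_inside[OF paths(2,1,3) ne(2)] by blast
qed

text \<open>Three such paths would form a subdivision of K_{2,3}: the path forced inside has an
  inner vertex as well.\<close>

lemma no_theta:
  assumes "graph_path E x y W F" "graph_path E x y W' F'" "graph_path E x y W'' F''"
    and "W \<inter> W' = {x, y}" "W \<inter> W'' = {x, y}" "W' \<inter> W'' = {x, y}"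
    and "W \<noteq> {x, y}" "W' \<noteq> {x, y}" "W'' \<noteq> {x, y}"
  shows False
  using third_path_inside(4)[OF assms(1-8)] path_not_inside[OF assms(3,1,2,9)] by blast

lemma trace_Int_vertices:
  assumes "G \<subseteq> E"
  shows "trace G \<inter> p ` V = p ` \<Union>G"
proof -
  have "path_image (\<gamma> e) \<inter> p ` V = p ` e" if "e \<in> G" for e
  proof -
    have "e \<in> E" using that assms by auto
    then show ?thesis using plane unfolding plane_drawing_def by simp
  qed
  then have "(\<Union>e\<in>G. path_image (\<gamma> e) \<inter> p ` V) = p ` \<Union>G"
    by (simp add: image_Union)
  then show ?thesis unfolding trace_def by blast
qed

text \<open>The chord ends alternate along the cycle \<open>v 0, ..., v j\<close>, as 0 <
  \<open>h\<close> < \<open>Suc h\<close> < \<open>l\<close>. By \<open>third_path_inside\<close>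
  each chord runs inside the cycle, where alternating chords cannot avoid each other. That
  \<open>h\<close> and \<open>Suc h\<close> are consecutive is the situation produced by a path
  rotation.\<close>

lemma no_crossing_chords:
  assumes inj: "inj_on v {0..j}" and edges: "\<And>k. k < j \<Longrightarrow> {v k, v (Suc k)} \<in> E"
    and closing: "{v 0, v j} \<in> E" and chords: "{v 0, v (Suc h)} \<in> E" "{v h, v l} \<in> E"
    and order: "1 \<le> h" "Suc h < l" "l \<le> j"
  shows False
proof -
  define F where "F = (\<lambda>a b. (\<lambda>k. {v k, v (Suc k)}) ` {a..<b})"
  have v_eq: "v a = v b \<longleftrightarrow> a = b" if "a \<le> j" "b \<le> j" for a b
    using inj_on_eq_iff[OF inj] that by simp
  have v_Int: "v ` S \<inter> v ` T = v ` (S \<inter> T)" if "S \<subseteq> {0..j}" "T \<subseteq> {0..j}" for S T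
    using inj_on_image_Int[OF inj that] by simp
  have v_mem: "v a \<in> v ` S \<longleftrightarrow> a \<in> S" if "a \<le> j" "S \<subseteq> {0..j}" for a S
    using inj_on_image_mem_iff[OF inj _ that(2)] that(1) by simp
  have F_Un: "F a b \<union> F b c = F a c" if "a \<le> b" "b \<le> c" for a b c
  proof -
    have "{a..<b} \<union> {b..<c} = {a..<c}" using that by auto
    then show ?thesis unfolding F_def by (metis image_Un)
  qed
  have segment: "graph_path E (v a) (v b) (v ` {a..b}) (F a b)" if "a < b" "b \<le> j" for a b
    unfolding F_def using that edges
    by (intro graph_path_interval) (auto intro: inj_on_subset[OF inj])
  have closing_path: "graph_path E (v 0) (v j) {v 0, v j} {{v 0, v j}}"
    using closing order v_eq by (intro graph_path.edge) auto
  \<comment> \<open>The other way round the cycle: from \<open>v 0\<close> along the closing edge to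
    \<open>v j\<close>, then down to \<open>v a\<close>. For \<open>a = j\<close> only the closing
    edge remains.\<close>
  have around: "graph_path E (v 0) (v a) (v ` insert 0 {a..j}) (insert {v 0, v j} (F a j))"
    if "0 < a" "a \<le> j" for a
  proof (cases "a = j")
    case True
    then show ?thesis using closing_path by (simp add: F_def)
  next
    case False
    then have "graph_path E (v j) (v a) (v ` {a..j}) (F a j)"
      using segment that graph_path_reverse by (metis le_neq_implies_less order_refl)
    moreover have "{v 0, v j} \<inter> v ` {a..j} = {v j}"
      using v_Int[of "{0, j}" "{a..j}"] that by auto
    ultimately have "graph_path E (v 0) (v a) ({v 0, v j} \<union> v ` {a..j}) ({{v 0, v j}} \<union> F a j)"
      using graph_path_append[OF closing_path] by blast
    moreover have "{v 0, v j} \<union> v ` {a..j} = v ` insert 0 {a..j}"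
      using that by auto
    ultimately show ?thesis by simp
  qed
  have chord1: "graph_path E (v 0) (v (Suc h)) (v ` {0, Suc h}) {{v 0, v (Suc h)}}"
    using graph_path.edge[OF chords(1)] v_eq order by simp
  have chord2: "graph_path E (v h) (v l) (v ` {h, l}) {{v h, v l}}"
    using graph_path.edge[OF chords(2)] v_eq order by simp
  \<comment> \<open>\<open>A\<close> and \<open>B\<close> are the two halves of the cycle between
    the ends of the first chord; \<open>C\<close> and \<open>D\<close> below are those for the
    second chord.\<close>
  have A: "graph_path E (v 0) (v (Suc h)) (v ` {0..Suc h}) (F 0 (Suc h))"
    using segment order by simp
  have B: "graph_path E (v 0) (v (Suc h)) (v ` insert 0 {Suc h..j}) (insert {v 0, v j} (F (Suc h) j))"
    using around order by simp
  have sets1: "{0..Suc h} \<inter> insert 0 {Suc h..j} = {0, Suc h}" "{0..Suc h} \<inter> {0, Suc h} = {0, Suc h}"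
    "insert 0 {Suc h..j} \<inter> {0, Suc h} = {0, Suc h}"
    using order by auto
  have meet1: "v ` {0..Suc h} \<inter> v ` insert 0 {Suc h..j} = {v 0, v (Suc h)}"
    "v ` {0..Suc h} \<inter> v ` {0, Suc h} = {v 0, v (Suc h)}"
    "v ` insert 0 {Suc h..j} \<inter> v ` {0, Suc h} = {v 0, v (Suc h)}"
    using order sets1 by (subst v_Int; simp)+
  have "v h \<in> v ` {0..Suc h}" "v h \<notin> {v 0, v (Suc h)}"
    "v l \<in> v ` insert 0 {Suc h..j}" "v l \<notin> {v 0, v (Suc h)}"
    using order by (auto simp: v_eq)
  then have ne1: "v ` {0..Suc h} \<noteq> {v 0, v (Suc h)}" "v ` insert 0 {Suc h..j} \<noteq> {v 0, v (Suc h)}"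
    by metis+
  note third1 = third_path_inside[OF A B chord1 meet1 ne1]
  have C: "graph_path E (v h) (v l) (v ` {h..l}) (F h l)"
    using segment order by simp
  have D: "graph_path E (v h) (v l) (v ` ({0..h} \<union> insert 0 {l..j})) (F 0 h \<union> insert {v 0, v j} (F l j))"
  proof -
    have D1: "graph_path E (v h) (v 0) (v ` {0..h}) (F 0 h)"
      using graph_path_reverse[OF segment[of 0 h]] order by simp
    have D2: "graph_path E (v 0) (v l) (v ` insert 0 {l..j}) (insert {v 0, v j} (F l j))"
      using around[of l] order by simp
    have "{0..h} \<inter> insert 0 {l..j} = {0}" using order by auto
    then have D3: "v ` {0..h} \<inter> v ` insert 0 {l..j} = {v 0}"
      using v_Int[of "{0..h}" "insert 0 {l..j}"] order by auto
    show ?thesis using graph_path_append[OF D1 D2 D3] unfolding image_Un .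
  qed
  have sets2: "{h..l} \<inter> ({0..h} \<union> insert 0 {l..j}) = {h, l}" "{h..l} \<inter> {h, l} = {h, l}"
    "({0..h} \<union> insert 0 {l..j}) \<inter> {h, l} = {h, l}"
    using order by auto
  have meet2: "v ` {h..l} \<inter> v ` ({0..h} \<union> insert 0 {l..j}) = {v h, v l}"
    "v ` {h..l} \<inter> v ` {h, l} = {v h, v l}"
    "v ` ({0..h} \<union> insert 0 {l..j}) \<inter> v ` {h, l} = {v h, v l}"
    using order sets2 by (subst v_Int; simp)+
  have "v (Suc h) \<in> v ` {h..l}" "v (Suc h) \<notin> {v h, v l}"
    "v 0 \<in> v ` ({0..h} \<union> insert 0 {l..j})" "v 0 \<notin> {v h, v l}"
    using order by (auto simp: v_eq)
  then have ne2: "v ` {h..l} \<noteq> {v h, v l}" "v ` ({0..h} \<union> insert 0 {l..j}) \<noteq> {v h, v l}"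
    by metis+
  note third2 = third_path_inside[OF C D chord2 meet2 ne2]
  \<comment> \<open>Both splittings describe the same closed curve, so both chords lie in the same
    region.\<close>
  have "F h l \<union> (F 0 h \<union> insert {v 0, v j} (F l j)) = insert {v 0, v j} (F 0 h \<union> F h l \<union> F l j)"
    by auto
  also have "\<dots> = insert {v 0, v j} (F 0 (Suc h) \<union> F (Suc h) j)"
    using order by (simp add: F_Un)
  also have "\<dots> = F 0 (Suc h) \<union> insert {v 0, v j} (F (Suc h) j)"
    by auto
  finally have same_cycle: "trace (F h l) \<union> trace (F 0 h \<union> insert {v 0, v j} (F l j)) =
      trace (F 0 (Suc h)) \<union> trace (insert {v 0, v j} (F (Suc h) j))"
    by (metis trace_Un)
  have l_notin: "v l \<notin> v ` {0..Suc h}" and h_notin: "v h \<notin> v ` insert 0 {Suc h..j}"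
    using order by (auto simp: v_eq)
  have Q: "trace {{v h, v l}} \<inter> trace G = p ` ({v h, v l} \<inter> W)"
    if "graph_path E (v 0) (v (Suc h)) W G" "v l \<notin> W \<or> v h \<notin> W" for G W
  proof -
    have "{{v h, v l}} \<inter> G = {}" using that graph_path_Union[OF that(1)] by blast
    then show ?thesis
      using trace_Int[of "{{v h, v l}}" G] chords(2) graph_path_edges[OF that(1)] graph_path_Union[OF that(1)]
      by simp
  qed
  have vsimps: "{v h, v l} \<inter> v ` {0..Suc h} = {v h}" "{v h, v l} \<inter> v ` insert 0 {Suc h..j} = {v l}"
    "{v h, v l} \<inter> v ` {0, Suc h} = {}"
    using order by (auto simp: v_eq)
  have outer_vertex: "p (v k) \<notin> inside (trace G \<union> trace G')"
    if "graph_path E x y W G" "graph_path E x' y' W' G'" "k \<le> j" for x y W G x' y' W' G' k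
  proof (rule vertex_not_inside)
    have "v k \<in> v ` {0..j}" using that by simp
    then show "v k \<in> V" using graph_path_subset[OF segment[of 0 j]] order by auto
    show "closed (trace G \<union> trace G')" using closed_trace_paths that by blast
    show "trace G \<union> trace G' \<subseteq> drawing_points V E p \<gamma>"
      using that(1,2)[THEN graph_path_edges] trace_subset_drawing by simp
  qed
  show False
  proof (rule no_crossing_chords_inside[OF A[THEN trace_graph_path] B[THEN trace_graph_path]
        chord1[THEN trace_graph_path] chord2[THEN trace_graph_path] third1(1-3)])
    show "trace {{v h, v l}} \<inter> trace (F 0 (Suc h)) = {p (v h)}"
      using Q[OF A] l_notin vsimps by simp
    show "trace {{v h, v l}} \<inter> trace (insert {v 0, v j} (F (Suc h) j)) = {p (v l)}"
      using Q[OF B] h_notin vsimps by simp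
    show "trace {{v h, v l}} \<inter> trace {{v 0, v (Suc h)}} = {}"
      using Q[OF chord1] vsimps by auto
    show "trace {{v 0, v (Suc h)}} - {p (v 0), p (v (Suc h))}
        \<subseteq> inside (trace (F 0 (Suc h)) \<union> trace (insert {v 0, v j} (F (Suc h) j)))"
      by (rule third1(4))
    show "trace {{v h, v l}} - {p (v h), p (v l)}
        \<subseteq> inside (trace (F 0 (Suc h)) \<union> trace (insert {v 0, v j} (F (Suc h) j)))"
      using third2(4) same_cycle by simp
    show "p (v h) \<notin> inside (trace (insert {v 0, v j} (F (Suc h) j)) \<union> trace {{v 0, v (Suc h)}})"
      using outer_vertex[OF B chord1] order by simp
    show "p (v l) \<notin> inside (trace (F 0 (Suc h)) \<union> trace {{v 0, v (Suc h)}})"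
      using outer_vertex[OF A chord1] order by simp
  qed
qed

text \<open>A new edge \<open>e\<close> that is not in \<open>E\<close> is drawn along the two edges
  through a dropped vertex with neighbourhood exactly \<open>e\<close>. The new drawing thus uses
  only points of the old one, and all vertices stay on the outer face. This covers deleting vertices
  and suppressing vertices of degree 2.\<close>

lemma outerplanar_suppress:
  assumes "U \<subseteq> V"
    and E': "\<And>e. e \<in> E' \<Longrightarrow> e \<subseteq> U \<and> card e = 2 \<and> (e \<in> E \<or> (\<exists>x\<in>V - U. nbhd E x = e))"
  shows "simple_graph U E'" "outerplanar U E'"
proof -
  show "simple_graph U E'"
    using E' finite_subset[OF assms(1)] simple unfolding simple_graph_def by simp
  \<comment> \<open>\<open>mid e\<close> is the dropped vertex through which \<open>e\<close> is
    redrawn; it has a meaning only for \<open>e\<close> outside \<open>E\<close>.\<close>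
  define mid where "mid e = (SOME x. x \<in> V - U \<and> nbhd E x = e)" for e
  have mid: "mid e \<in> V - U \<and> nbhd E (mid e) = e" if "e \<in> E'" "e \<notin> E" for e
    using E'[OF that(1)] that(2) someI_ex[of "\<lambda>x. x \<in> V - U \<and> nbhd E x = e"]
    unfolding mid_def by blast
  define W where "W e = (if e \<in> E then e else insert (mid e) e)" for e
  have W: "W e \<inter> U = e" if "e \<in> E'" for e
    using E'[OF that] mid[OF that] by (auto simp: W_def)
  \<comment> \<open>A dropped vertex serves one edge only, because its neighbourhood determines that
    edge.\<close>
  have W_Int: "W e \<inter> W e' = e \<inter> e'" if "e \<in> E'" "e' \<in> E'" "e \<noteq> e'" for e e'
  proof -
    have "mid e \<noteq> mid e'" if "e \<notin> E" "e' \<notin> E"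
      using mid[OF \<open>e \<in> E'\<close>] mid[OF \<open>e' \<in> E'\<close>] that \<open>e \<noteq> e'\<close> by metis
    moreover have "mid e \<notin> e'" if "e \<notin> E"
      using mid[OF \<open>e \<in> E'\<close> that] E'[OF \<open>e' \<in> E'\<close>] by auto
    moreover have "mid e' \<notin> e" if "e' \<notin> E"
      using mid[OF \<open>e' \<in> E'\<close> that] E'[OF \<open>e \<in> E'\<close>] by auto
    ultimately show ?thesis by (auto simp: W_def)
  qed
  have "\<exists>x y F. e = {x, y} \<and> graph_path E x y (W e) F" if "e \<in> E'" for e
  proof -
    obtain x y where xy: "e = {x, y}" "x \<noteq> y" using E'[OF \<open>e \<in> E'\<close>] by (auto simp: card_2_iff)
    show ?thesis
    proof (cases "e \<in> E")
      case True
      then have "graph_path E x y (W e) {e}"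
        using graph_path.edge[of x y E] xy by (simp add: W_def)
      then show ?thesis using xy by blast
    next
      case False
      have "y \<in> nbhd E (mid e)" "x \<in> nbhd E (mid e)" "mid e \<notin> e"
        using mid[OF \<open>e \<in> E'\<close> False] E'[OF \<open>e \<in> E'\<close>] xy by auto
      then have "graph_path E x y {x, mid e, y} {{x, mid e}, {mid e, y}}"
        using xy by (intro graph_path_two_edges) (auto simp: insert_commute nbhd_def)
      moreover have "{x, mid e, y} = W e" using xy False by (auto simp: W_def)
      ultimately show ?thesis using xy by metis
    qed
  qed
  then obtain X Y F where XY: "\<And>e. e \<in> E' \<Longrightarrow> e = {X e, Y e}"
    and path: "\<And>e. e \<in> E' \<Longrightarrow> graph_path E (X e) (Y e) (W e) (F e)"
    by metis
  have "\<exists>g. arc g \<and> path_image g = trace (F e) \<and> pathstart g = p (X e) \<and> pathfinish g = p (Y e)"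
    if "e \<in> E'" for e
    using trace_graph_path[OF path[OF that]] unfolding arc_between_def .
  then obtain \<delta> where \<delta>: "\<And>e. e \<in> E' \<Longrightarrow> arc (\<delta> e) \<and> path_image (\<delta> e) = trace (F e) \<and>
      pathstart (\<delta> e) = p (X e) \<and> pathfinish (\<delta> e) = p (Y e)"
    by metis
  have F: "F e \<subseteq> E" "\<Union>(F e) = W e" if "e \<in> E'" for e
    using graph_path_edges graph_path_Union path that by metis+
  have inj: "inj_on p V" using plane by (simp add: plane_drawing_def)
  have "plane_drawing U E' p \<delta>"
    unfolding plane_drawing_def
  proof (intro conjI ballI impI)
    show "inj_on p U" using inj assms(1) inj_on_subset by blast
    fix e assume e: "e \<in> E'"
    show "arc (\<delta> e)" using \<delta> e by blast
    show "{pathstart (\<delta> e), pathfinish (\<delta> e)} = p ` e" using \<delta>[OF e] XY[OF e] by (metis image_empty image_insert)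
    have "path_image (\<delta> e) \<inter> p ` U = (trace (F e) \<inter> p ` V) \<inter> p ` U"
      using \<delta>[OF e] assms(1) by auto
    also have "\<dots> = p ` W e \<inter> p ` U" using trace_Int_vertices[OF F(1)[OF e]] F(2)[OF e] by simp
    also have "\<dots> = p ` (W e \<inter> U)"
      using inj graph_path_subset[OF path[OF e]] assms(1) by (intro inj_on_image_Int[symmetric])
    finally show "path_image (\<delta> e) \<inter> p ` U = p ` e" using W e by simp
    fix e' assume e': "e' \<in> E'" "e \<noteq> e'"
    have "F e \<inter> F e' = {}"
    proof (rule ccontr)
      assume "F e \<inter> F e' \<noteq> {}"
      then obtain f where f: "f \<in> F e" "f \<in> F e'" by blast
      then have "f \<subseteq> e \<inter> e'" using F(2)[OF e] F(2)[OF e'(1)] W_Int[OF e e'] by blast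
      moreover have "card f = 2" using f F(1)[OF e] edge_card by blast
      moreover have "card e = 2" "card e' = 2" using E'[OF e] E'[OF e'(1)] by auto
      ultimately have "f = e" "f = e'"
        using card_seteq[of e f] card_seteq[of e' f] card_ge_0_finite[of e] card_ge_0_finite[of e'] by auto
      then show False using e' by simp
    qed
    then have "trace (F e) \<inter> trace (F e') = p ` (W e \<inter> W e')"
      using trace_Int[OF F(1)[OF e] F(1)[OF e'(1)]] F(2)[OF e] F(2)[OF e'(1)] by simp
    then show "path_image (\<delta> e) \<inter> path_image (\<delta> e') = p ` (e \<inter> e')"
      using \<delta>[OF e] \<delta>[OF e'(1)] W_Int[OF e e'] by simp
  qed
  moreover have "p ` U \<subseteq> frontier (outside (drawing_points U E' p \<delta>))"
  proof
    fix z assume z: "z \<in> p ` U"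
    \<comment> \<open>Fewer points are drawn, so the outer face can only grow, and a vertex in its
      closure stays there.\<close>
    have "drawing_points U E' p \<delta> \<subseteq> drawing_points V E p \<gamma>"
    proof -
      have "path_image (\<delta> e) \<subseteq> drawing_points V E p \<gamma>" if "e \<in> E'" for e
        using \<delta>[OF that] trace_subset_drawing[OF F(1)[OF that]] by simp
      moreover have "p ` U \<subseteq> drawing_points V E p \<gamma>"
        using assms(1) by (auto simp: drawing_points_def)
      ultimately show ?thesis unfolding drawing_points_def[of U] by (simp add: UN_least)
    qed
    then have "outside (drawing_points V E p \<gamma>) \<subseteq> outside (drawing_points U E' p \<delta>)"
      by (rule outside_mono)
    moreover have "z \<in> closure (outside (drawing_points V E p \<gamma>))"
      using outer z assms(1) by (auto simp: frontier_def)
    ultimately have "z \<in> closure (outside (drawing_points U E' p \<delta>))"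
      using closure_mono by blast
    moreover have "z \<notin> outside (drawing_points U E' p \<delta>)"
      using z outside_no_overlap[of "drawing_points U E' p \<delta>"] unfolding drawing_points_def by blast
    ultimately show "z \<in> frontier (outside (drawing_points U E' p \<delta>))"
      unfolding frontier_def using interior_subset by blast
  qed
  ultimately show "outerplanar U E'" unfolding outerplanar_def by blast
qed

end

subsection \<open>Light edges\<close>

lemma outerplanar_obtains_drawing:
  assumes "simple_graph V E" "outerplanar V E"
  obtains p \<gamma> where "outerplane_drawing V E p \<gamma>"
  using assms unfolding outerplanar_def outerplane_drawing_def by blast

section \<open>Longest paths and their rotations\<close>

definition vertex_path :: "'a set \<Rightarrow> 'a set set \<Rightarrow> (nat \<Rightarrow> 'a) \<Rightarrow> nat \<Rightarrow> bool" where
  "vertex_path V E v n \<longleftrightarrow>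
     0 < n \<and> inj_on v {..<n} \<and> v ` {..<n} \<subseteq> V \<and> (\<forall>k. Suc k < n \<longrightarrow> {v k, v (Suc k)} \<in> E)"

lemma vertex_path_Cons:
  assumes "vertex_path V E v n" "y \<in> V" "y \<notin> v ` {..<n}" "{v 0, y} \<in> E"
  shows "vertex_path V E (case_nat y v) (Suc n)"
  unfolding vertex_path_def
proof (intro conjI allI impI)
  show "inj_on (case_nat y v) {..<Suc n}"
    using assms by (auto simp: vertex_path_def inj_on_def split: nat.splits)
  show "case_nat y v ` {..<Suc n} \<subseteq> V"
    using assms by (auto simp: vertex_path_def image_subset_iff split: nat.splits)
  show "{case_nat y v k, case_nat y v (Suc k)} \<in> E" if "Suc k < Suc n" for k
    using assms that by (auto simp: vertex_path_def insert_commute split: nat.splits)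
qed simp

text \<open>A Posa rotation: the chord from \<open>v 0\<close> to \<open>v (Suc h)\<close> replaces
  the path edge from \<open>v h\<close> to \<open>v (Suc h)\<close>, and the reversed initial
  segment makes \<open>v h\<close> the new first vertex.\<close>

lemma vertex_path_rotate:
  assumes "vertex_path V E v n" "Suc h < n" "{v 0, v (Suc h)} \<in> E"
  shows "vertex_path V E (\<lambda>k. if k \<le> h then v (h - k) else v k) n" (is "vertex_path V E ?w n")
  unfolding vertex_path_def
proof (intro conjI allI impI)
  have inj: "a = b" if "v a = v b" "a < n" "b < n" for a b
    using assms(1) that by (auto simp: vertex_path_def inj_on_def)
  show "inj_on ?w {..<n}"
    using assms(2) by (auto simp: inj_on_def split: if_splits dest!: inj)
  show "?w ` {..<n} \<subseteq> V"
    using assms by (auto simp: vertex_path_def)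
  show "{?w k, ?w (Suc k)} \<in> E" if "Suc k < n" for k
  proof -
    consider "Suc k \<le> h" | "k = h" | "h < k" by linarith
    then show ?thesis
    proof cases
      case 1
      then have "{v (h - Suc k), v (Suc (h - Suc k))} \<in> E" "Suc (h - Suc k) = h - k"
        using assms(1,2) by (auto simp: vertex_path_def)
      then show ?thesis using 1 by (simp add: insert_commute)
    next
      case 2
      then show ?thesis using assms(3) by simp
    next
      case 3
      then show ?thesis using assms(1) that by (simp add: vertex_path_def)
    qed
  qed
qed (use assms in simp)

lemma nbhd_subset: "simple_graph V E \<Longrightarrow> nbhd E x \<subseteq> V - {x}"
  unfolding simple_graph_def nbhd_def by force

lemma finite_nbhd: "simple_graph V E \<Longrightarrow> finite (nbhd E x)"
  using nbhd_subset[of V E x] finite_subset[of "nbhd E x" V] unfolding simple_graph_def by blast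

lemma nbhd_commute: "y \<in> nbhd E x \<longleftrightarrow> x \<in> nbhd E y"
  by (simp add: nbhd_def insert_commute)

text \<open>The end of a longest path is never a cut vertex, because its neighbours lie on the path. Among
  the longest paths whose end has a chord, take the shortest such chord, from \<open>v 0\<close> to \<open>v (Suc h)\<close>:
  a third neighbour of \<open>v 0\<close> and one of the other rotated end \<open>v h\<close> would give crossing chords.\<close>

lemma outerplanar_end_vertex:
  assumes simple: "simple_graph V E" and outer: "outerplanar V E" and "V \<noteq> {}"
  obtains w where "w \<in> V" "card (nbhd E w) \<le> 2"
    "\<And>x y. x \<in> nbhd E w \<Longrightarrow> y \<in> nbhd E w \<Longrightarrow> x \<noteq> y \<Longrightarrow> \<exists>W F. graph_path E x y W F \<and> w \<notin> W"
proof -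
  obtain p \<gamma> where "outerplane_drawing V E p \<gamma>" using outerplanar_obtains_drawing simple outer by blast
  then interpret outerplane_drawing V E p \<gamma> .
  have "finite V" using simple by (simp add: simple_graph_def)
  obtain a where "a \<in> V" using \<open>V \<noteq> {}\<close> by blast
  then have "vertex_path V E (\<lambda>_. a) 1" by (auto simp: vertex_path_def inj_on_def)
  then have "\<exists>n v. vertex_path V E v n" by blast
  moreover have "n \<le> card V" if "\<exists>v. vertex_path V E v n" for n
    using that card_inj_on_le[of _ "{..<n}" V] \<open>finite V\<close> by (auto simp: vertex_path_def)
  ultimately obtain n where n: "\<exists>v. vertex_path V E v n"
    and longest: "\<And>m. \<exists>v. vertex_path V E v m \<Longrightarrow> m \<le> n"
    using GreatestI_ex_nat[of "\<lambda>n. \<exists>v. vertex_path V E v n" "card V"]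
      Greatest_le_nat[of "\<lambda>n. \<exists>v. vertex_path V E v n" _ "card V"] by metis
  have on_path: "\<exists>k. 1 \<le> k \<and> k < n \<and> y = v k" if "vertex_path V E v n" "y \<in> nbhd E (v 0)" for v y
  proof -
    have "y \<in> V" "y \<noteq> v 0" "{v 0, y} \<in> E"
      using that nbhd_subset[OF simple] by (auto simp: nbhd_def)
    moreover have "y \<in> v ` {..<n}"
    proof (rule ccontr)
      assume "y \<notin> v ` {..<n}"
      then have "vertex_path V E (case_nat y v) (Suc n)"
        using that calculation by (intro vertex_path_Cons) auto
      then show False using longest[of "Suc n"] by auto
    qed
    ultimately show ?thesis by (metis One_nat_def Suc_leI imageE lessThan_iff neq0_conv)
  qed
  have "\<exists>v. vertex_path V E v n \<and> card (nbhd E (v 0)) \<le> 2"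
  proof (rule ccontr)
    assume neg: "\<not> ?thesis"
    \<comment> \<open>By \<open>neg\<close> the first vertex has at least three neighbours, all on
      the path, so one of them avoids both position 1 and any given position
      \<open>i\<close>.\<close>
    have third: "\<exists>k. 2 \<le> k \<and> k < n \<and> k \<noteq> i \<and> {v 0, v k} \<in> E" if "vertex_path V E v n" for v i
    proof (rule ccontr)
      assume *: "\<not> ?thesis"
      have "nbhd E (v 0) \<subseteq> {v 1, v i}"
      proof
        fix y assume y: "y \<in> nbhd E (v 0)"
        then obtain k where "1 \<le> k" "k < n" "y = v k" using on_path \<open>vertex_path V E v n\<close> by blast
        then have "k = 1 \<or> k = i" using * y by (auto simp: nbhd_def)
        then show "y \<in> {v 1, v i}" using \<open>y = v k\<close> by blast
      qed
      then have "card (nbhd E (v 0)) \<le> card {v 1, v i}" by (intro card_mono) auto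
      also have "\<dots> \<le> 2" using card_insert_le_m1[of 2 "{v i}" "v 1"] by simp
      finally show False using neg \<open>vertex_path V E v n\<close> by blast
    qed
    \<comment> \<open>The minimum is taken over the chords of all longest paths, so it also bounds
      the chords of the rotated path \<open>w\<close>.\<close>
    define Q where "Q = (\<lambda>i. \<exists>v. vertex_path V E v n \<and> 2 \<le> i \<and> i < n \<and> {v 0, v i} \<in> E)"
    have "\<exists>i. Q i" using n third[of _ 1] unfolding Q_def by metis
    then obtain i where i: "Q i" "\<And>k. Q k \<Longrightarrow> i \<le> k"
      using LeastI_ex[of Q] Least_le[of Q] by blast
    define h where "h = i - 1"
    obtain v where "vertex_path V E v n" "2 \<le> i" "i < n" "{v 0, v i} \<in> E"
      using i(1) unfolding Q_def by blast
    then have v: "vertex_path V E v n" "1 \<le> h" "Suc h < n" "{v 0, v (Suc h)} \<in> E"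
      by (auto simp: h_def)
    have least: "Suc h \<le> k" if "vertex_path V E u n" "2 \<le> k" "k < n" "{u 0, u k} \<in> E" for u k
      using i(2)[of k] that \<open>2 \<le> i\<close> unfolding Q_def h_def by auto
    obtain j where j: "Suc h < j" "j < n" "{v 0, v j} \<in> E"
      using third[OF v(1), of "Suc h"] least[OF v(1)] by (metis le_neq_implies_less)
    define w where "w = (\<lambda>k. if k \<le> h then v (h - k) else v k)"
    have w: "vertex_path V E w n" unfolding w_def using v by (intro vertex_path_rotate)
    obtain l where l: "Suc h < l" "l < n" "{w 0, w l} \<in> E"
      using third[OF w, of "Suc h"] least[OF w] by (metis le_neq_implies_less)
    have vertex_path_inj: "inj_on u {0..m}" "\<And>k. k < m \<Longrightarrow> {u k, u (Suc k)} \<in> E"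
      if "vertex_path V E u n" "m < n" for u m
      using that by (auto simp: vertex_path_def inj_on_def)
    \<comment> \<open>The cycle is closed by the chord that reaches farther. If this is the chord of
      \<open>w\<close>, then \<open>w\<close> takes the role of \<open>v\<close>, and the short
      chord is the path edge from \<open>v h\<close> to \<open>v (Suc h)\<close> that the rotation
      removed.\<close>
    show False
    proof (cases "l \<le> j")
      case True
      have "{v h, v l} \<in> E" using l by (simp add: w_def)
      then show False
        using no_crossing_chords[OF vertex_path_inj[OF v(1) j(2)] j(3) v(4)] v(2) l(1) True by blast
    next
      case False
      have "{w 0, w (Suc h)} \<in> E" using v by (simp add: w_def vertex_path_def)
      moreover have "{w h, w j} \<in> E" using j by (simp add: w_def)
      ultimately show False
        using no_crossing_chords[OF vertex_path_inj[OF w l(2)] l(3), of h j] v(2) j(1) False by simp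
    qed
  qed
  then obtain v where v: "vertex_path V E v n" "card (nbhd E (v 0)) \<le> 2" by blast
  have segment: "\<exists>W F. graph_path E (v k) (v l) W F \<and> v 0 \<notin> W" if "1 \<le> k" "k < l" "l < n" for k l
  proof -
    have "graph_path E (v k) (v l) (v ` {k..l}) ((\<lambda>k. {v k, v (Suc k)}) ` {k..<l})"
      using v(1) that by (intro graph_path_interval) (auto simp: vertex_path_def inj_on_def)
    moreover have "v 0 \<notin> v ` {k..l}"
    proof -
      have "{k..l} \<subseteq> {..<n}" "0 \<notin> {k..l}" "0 \<in> {..<n}" using that by auto
      then show ?thesis using v(1) inj_on_image_mem_iff unfolding vertex_path_def by metis
    qed
    ultimately show ?thesis by blast
  qed
  show thesis
  proof (rule that[of "v 0"])
    show "v 0 \<in> V" using v(1) by (auto simp: vertex_path_def)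
    show "card (nbhd E (v 0)) \<le> 2" by (rule v)
    fix x y assume "x \<in> nbhd E (v 0)" "y \<in> nbhd E (v 0)" "x \<noteq> y"
    then obtain k l where "1 \<le> k" "k < n" "x = v k" "1 \<le> l" "l < n" "y = v l" "k \<noteq> l"
      using on_path[OF v(1)] by metis
    then show "\<exists>W F. graph_path E x y W F \<and> v 0 \<notin> W"
      using segment[of k l] segment[of l k] graph_path_reverse by (metis linorder_neqE_nat)
  qed
qed

text \<open>In a counterexample the vertices of degree 2 are independent; suppress them all. The suppressed
  graph has an end vertex \<open>w\<close> of degree at most 2, while \<open>w\<close> has degree at least 5 in the original
  graph, so two suppressed vertices \<open>a\<close>, \<open>b\<close> join \<open>w\<close> to the same \<open>u\<close>. Since \<open>w\<close> is no cut vertex, a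
  third path joins \<open>w\<close> to \<open>u\<close>.\<close>

lemma outerplanar_light_edge:
  assumes simple: "simple_graph V E" and outer: "outerplanar V E" and "V \<noteq> {}"
  shows "\<exists>x\<in>V. card (nbhd E x) \<le> 1 \<or> card (nbhd E x) = 2 \<and> (\<exists>y\<in>nbhd E x. card (nbhd E y) \<le> 4)"
proof (rule ccontr)
  assume neg: "\<not> ?thesis"
  obtain p \<gamma> where "outerplane_drawing V E p \<gamma>" using outerplanar_obtains_drawing simple outer by blast
  then interpret G: outerplane_drawing V E p \<gamma> .
  have deg_ge_2: "2 \<le> card (nbhd E x)" if "x \<in> V" for x
  proof -
    have "\<not> card (nbhd E x) \<le> 1" using neg that by blast
    then show ?thesis by linarith
  qed
  have deg_ge_5: "5 \<le> card (nbhd E y)" if "x \<in> V" "card (nbhd E x) = 2" "y \<in> nbhd E x" for x y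
  proof -
    have "\<not> card (nbhd E y) \<le> 4" using neg that by blast
    then show ?thesis by linarith
  qed
  define T where "T = {x \<in> V. card (nbhd E x) = 2}"
  define U where "U = V - T"
  have T_nbhd: "nbhd E x \<subseteq> U" if "x \<in> T" for x
  proof
    fix y assume y: "y \<in> nbhd E x"
    then have "y \<in> V" using nbhd_subset[OF simple] by blast
    moreover have "5 \<le> card (nbhd E y)" using deg_ge_5 that y by (auto simp: T_def)
    ultimately show "y \<in> U" by (auto simp: U_def T_def)
  qed
  \<comment> \<open>The suppressed graph is kept simple: all vertices of \<open>T\<close> with the
    same two neighbours, and an edge of \<open>E\<close> joining these, merge into one edge.\<close>
  define E' where "E' = {e. e \<subseteq> U \<and> card e = 2 \<and> (e \<in> E \<or> (\<exists>x\<in>T. nbhd E x = e))}"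
  have VU: "V - U = T" "U \<subseteq> V" by (auto simp: U_def T_def)
  have H: "simple_graph U E'" "outerplanar U E'"
    using G.outerplanar_suppress[of U E'] VU by (auto simp: E'_def)
  have "U \<noteq> {}"
  proof -
    obtain x where x: "x \<in> V" using \<open>V \<noteq> {}\<close> by blast
    show ?thesis
    proof (cases "x \<in> T")
      case True
      then have "nbhd E x \<noteq> {}" by (auto simp: T_def)
      then show ?thesis using T_nbhd[OF True] by blast
    qed (use x in \<open>auto simp: U_def\<close>)
  qed
  then obtain w where w: "w \<in> U" "card (nbhd E' w) \<le> 2"
    and linked: "\<And>x y. x \<in> nbhd E' w \<Longrightarrow> y \<in> nbhd E' w \<Longrightarrow> x \<noteq> y \<Longrightarrow>
      \<exists>W F. graph_path E' x y W F \<and> w \<notin> W"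
    using outerplanar_end_vertex[OF H] by blast
  \<comment> \<open>\<open>M u\<close> collects the suppressed vertices behind the edge from
    \<open>w\<close> to \<open>u\<close>. Each neighbour of \<open>w\<close> is one in the
    suppressed graph or belongs to some \<open>M u\<close>.\<close>
  define M where "M u = {x \<in> T. nbhd E x = {w, u}}" for u
  have fin: "finite V" using simple by (simp add: simple_graph_def)
  have finM: "finite (M u)" for u using fin by (auto simp: M_def T_def)
  have finN: "finite (nbhd E' w)" using finite_nbhd[OF H(1)] .
  have N_neq: "u \<noteq> w" if "u \<in> nbhd E' w" for u using nbhd_subset[OF H(1)] that by blast
  have cover: "nbhd E w \<subseteq> nbhd E' w \<union> (\<Union>u\<in>nbhd E' w. M u)"
  proof
    fix y assume y: "y \<in> nbhd E w"
    then have yV: "y \<in> V" "y \<noteq> w" using nbhd_subset[OF simple] by blast+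
    show "y \<in> nbhd E' w \<union> (\<Union>u\<in>nbhd E' w. M u)"
    proof (cases "y \<in> T")
      case False
      then have "{w, y} \<in> E'" using y yV w by (auto simp: E'_def nbhd_def U_def)
      then show ?thesis by (simp add: nbhd_def)
    next
      case True
      have wy: "w \<in> nbhd E y" using y nbhd_commute by metis
      have c2: "card (nbhd E y) = 2" using True by (simp add: T_def)
      then obtain u where u: "nbhd E y = {w, u}"
        using wy by (metis card_2_iff insertE insert_commute singletonD)
      then have "{w, u} \<in> E'"
        using T_nbhd[OF True] c2 True by (auto simp: E'_def)
      then have "u \<in> nbhd E' w" "y \<in> M u" using u True by (auto simp: nbhd_def M_def)
      then show ?thesis by blast
    qed
  qed
  have M_path: "{w, a} \<in> E" "{a, u} \<in> E" "a \<noteq> w" "a \<noteq> u" "a \<in> T" if "a \<in> M u" for a u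
  proof -
    have a: "a \<in> T" "nbhd E a = {w, u}" using that by (auto simp: M_def)
    then have "w \<in> nbhd E a" "u \<in> nbhd E a" by auto
    then show "{w, a} \<in> E" "{a, u} \<in> E" by (auto simp: nbhd_def insert_commute)
    show "a \<in> T" by (rule a)
    have "a \<notin> nbhd E a" using nbhd_subset[OF simple] by blast
    then show "a \<noteq> w" "a \<noteq> u" using a by auto
  qed
  \<comment> \<open>Three vertices with neighbours \<open>w\<close> and \<open>u\<close> would give
    K_{2,3}.\<close>
  have M_le_2: "card (M u) \<le> 2" if "u \<in> nbhd E' w" for u
  proof (rule ccontr)
    assume "\<not> ?thesis"
    then have "3 \<le> card (M u)" by simp
    then obtain A where "A \<subseteq> M u" "card A = 3" by (meson obtain_subset_with_card_n)
    then obtain a b c where abc: "a \<in> M u" "b \<in> M u" "c \<in> M u" "a \<noteq> b" "b \<noteq> c" "a \<noteq> c"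
      by (auto simp: card_3_iff)
    have path: "graph_path E w u {w, x, u} {{w, x}, {x, u}}" if "x \<in> M u" for x
      using M_path[OF that] N_neq[OF \<open>u \<in> nbhd E' w\<close>] by (intro graph_path_two_edges) auto
    show False
      using abc M_path(3,4)[OF abc(1)] M_path(3,4)[OF abc(2)] M_path(3,4)[OF abc(3)]
      by (intro G.no_theta[OF path[OF abc(1)] path[OF abc(2)] path[OF abc(3)]]) auto
  qed
  \<comment> \<open>Without a neighbour in \<open>T\<close>, all neighbours of \<open>w\<close>
    survive suppression and number at most 2, but vertices of \<open>U\<close> have degree at least
    3. A neighbour in \<open>T\<close> forces degree at least 5.\<close>
  have deg_w: "5 \<le> card (nbhd E w)"
  proof (cases "nbhd E w \<inter> T = {}")
    case True
    have "nbhd E w \<subseteq> nbhd E' w" using cover True by (auto simp: M_def)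
    then have "card (nbhd E w) \<le> 2" using w(2) card_mono[OF finN] le_trans by blast
    moreover have "2 \<le> card (nbhd E w)" "card (nbhd E w) \<noteq> 2" using w(1) deg_ge_2 by (auto simp: U_def T_def)
    ultimately show ?thesis by linarith
  next
    case False
    then obtain x where "x \<in> nbhd E w" "x \<in> T" by blast
    then show ?thesis using deg_ge_5[of x w] nbhd_commute[of x E w] by (auto simp: T_def)
  qed
  have "card (nbhd E w) \<le> card (nbhd E' w \<union> (\<Union>u\<in>nbhd E' w. M u))"
    using cover finN finM by (intro card_mono) auto
  also have "\<dots> \<le> card (nbhd E' w) + card (\<Union>u\<in>nbhd E' w. M u)" by (rule card_Un_le)
  also have "\<dots> \<le> card (nbhd E' w) + (\<Sum>u\<in>nbhd E' w. card (M u))"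
    using card_UN_le[OF finN] by simp
  finally have sum: "5 \<le> card (nbhd E' w) + (\<Sum>u\<in>nbhd E' w. card (M u))" using deg_w by simp
  \<comment> \<open>At most two neighbours, each with at most one suppressed vertex, account for
    only 4 of the at least 5 neighbours of \<open>w\<close>.\<close>
  have "\<exists>u\<in>nbhd E' w. 2 \<le> card (M u)"
  proof (rule ccontr)
    assume "\<not> ?thesis"
    then have "(\<Sum>u\<in>nbhd E' w. card (M u)) \<le> card (nbhd E' w) * 1"
      by (intro sum_bounded_above[where 'a = nat, simplified]) force
    then show False using sum w(2) by simp
  qed
  then obtain u where u: "u \<in> nbhd E' w" "2 \<le> card (M u)" by blast
  \<comment> \<open>A single neighbour \<open>u\<close> accounts for at most 1 + 2 neighbours of
    \<open>w\<close>.\<close>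
  have "nbhd E' w \<noteq> {u}"
  proof
    assume "nbhd E' w = {u}"
    then show False using sum M_le_2[OF u(1)] by simp
  qed
  then obtain u' where u': "u' \<in> nbhd E' w" "u' \<noteq> u" using u(1) by blast
  obtain A where "A \<subseteq> M u" "card A = 2" using u(2) by (meson obtain_subset_with_card_n)
  then obtain a b where ab: "a \<in> M u" "b \<in> M u" "a \<noteq> b" by (auto simp: card_2_iff)
  obtain W F where WF: "graph_path E' u' u W F" "w \<notin> W" using linked u(1) u' by blast
  have "{w, u'} \<in> E'" using u'(1) by (simp add: nbhd_def)
  then have path: "graph_path E' w u (insert w W) (insert {w, u'} F)"
    using WF by (rule graph_path.step)
  have "u' \<in> W" using graph_path_ends[OF WF(1)] by blast
  \<comment> \<open>\<open>a\<close> and \<open>b\<close> are restored next to the suppressed edges.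
    The edge \<open>{w, u}\<close> is left out, since it may stand for \<open>a\<close> or
    \<open>b\<close>, which can no longer be suppressed; the path through \<open>u'\<close> does not
    use it.\<close>
  define E'' where "E'' = (E' - {{w, u}}) \<union> {{w, a}, {a, u}, {w, b}, {b, u}}"
  have "{w, u} \<notin> insert {w, u'} F"
    using graph_path_direct_edge[OF path] \<open>u' \<in> W\<close> u'(2) N_neq[OF u'(1)] by auto
  then have path'': "graph_path E'' w u (insert w W) (insert {w, u'} F)"
    using graph_path_edges[OF path] by (intro graph_path_change_edges[OF path]) (auto simp: E''_def)
  have WU: "W \<subseteq> U"
    using graph_path_Union[OF WF(1)] graph_path_edges[OF WF(1)] by (auto simp: E'_def)
  have uU: "u \<in> U" using u(1) nbhd_subset[OF H(1)] by blast
  define U'' where "U'' = insert a (insert b U)"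
  have E'': "e \<subseteq> U'' \<and> card e = 2 \<and> (e \<in> E \<or> (\<exists>x\<in>V - U''. nbhd E x = e))" if "e \<in> E''" for e
  proof (cases "e \<in> {{w, a}, {a, u}, {w, b}, {b, u}}")
    case True
    then show ?thesis
      using M_path[OF ab(1)] M_path[OF ab(2)] w(1) uU by (auto simp: U''_def)
  next
    case False
    then have e: "e \<in> E'" "e \<noteq> {w, u}" using that by (auto simp: E''_def)
    have "x \<in> V - U''" if "x \<in> T" "nbhd E x = e" for x
      using that e(2) ab by (auto simp: U''_def U_def T_def M_def)
    then show ?thesis using e(1) by (auto simp: E'_def U''_def)
  qed
  have "U'' \<subseteq> V" using ab M_path(5) VU by (auto simp: U''_def T_def)
  note K = G.outerplanar_suppress[OF \<open>U'' \<subseteq> V\<close> E'']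
  obtain p'' \<gamma>'' where "outerplane_drawing U'' E'' p'' \<gamma>''" using outerplanar_obtains_drawing[OF K] by blast
  then interpret K: outerplane_drawing U'' E'' p'' \<gamma>'' .
  have notW: "a \<notin> W" "b \<notin> W" using M_path(5) ab WU by (auto simp: U_def)
  have *: "graph_path E'' w u {w, x, u} {{w, x}, {x, u}}" if "x = a \<or> x = b" for x
    using M_path(3,4)[OF ab(1)] M_path(3,4)[OF ab(2)] N_neq[OF u(1)] that
    by (intro graph_path_two_edges) (auto simp: E''_def)
  have "u \<in> W" using graph_path_ends[OF WF(1)] by blast
  show False
    using M_path(3,4)[OF ab(1)] M_path(3,4)[OF ab(2)] ab(3) notW \<open>u \<in> W\<close> \<open>u' \<in> W\<close> u'(2) N_neq[OF u'(1)]
    by (intro K.no_theta[OF *[of a] *[of b] path'']) auto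
qed

subsection \<open>Equitable tree-colorings\<close>

lemma card_le_2_imp_forest:
  assumes "finite W" "card W \<le> 2"
  shows "forest W E"
  unfolding forest_def is_cycle_def
  using assms card_mono[OF assms(1)] by (metis distinct_card le_trans not_less_eq_eq numeral_2_eq_2 numeral_3_eq_3)

text \<open>A cycle through \<open>s\<close> contains two different neighbours of \<open>s\<close>
  in \<open>W\<close>; any other cycle lies within \<open>W\<close>.\<close>

lemma forest_insert:
  assumes "finite W" and forest: "forest W (induced_edges E W)" and deg: "card (nbhd E s \<inter> W) \<le> 1"
  shows "forest (insert s W) (induced_edges E (insert s W))"
  unfolding forest_def
proof
  assume "\<exists>vs. is_cycle (insert s W) (induced_edges E (insert s W)) vs"
  then obtain vs where vs: "set vs \<subseteq> insert s W" "distinct vs" "3 \<le> length vs"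
    and edges: "\<And>i. i < length vs \<Longrightarrow> {vs ! i, vs ! (Suc i mod length vs)} \<in> E"
    by (auto simp: is_cycle_def induced_edges_def)
  show False
  proof (cases "s \<in> set vs")
    case False
    then have W: "set vs \<subseteq> W" using vs by blast
    have "{vs ! i, vs ! (Suc i mod length vs)} \<in> induced_edges E W" if "i < length vs" for i
    proof -
      have "Suc i mod length vs < length vs" using vs(3) by (intro mod_less_divisor) auto
      then show ?thesis using W edges[OF that] that nth_mem[of _ vs] by (auto simp: induced_edges_def)
    qed
    then show False using forest vs W unfolding forest_def is_cycle_def by blast
  next
    case True
    define n where "n = length vs"
    obtain k where k: "k < n" "s = vs ! k" using True by (auto simp: in_set_conv_nth n_def)
    \<comment> \<open>The cyclic neighbours of position \<open>k\<close>, with wrap-around at both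
      ends. They differ because a cycle has length at least 3.\<close>
    define next_idx where "next_idx = (if Suc k = n then 0 else Suc k)"
    define prev_idx where "prev_idx = (if k = 0 then n - 1 else k - 1)"
    have idx: "next_idx < n" "prev_idx < n" "next_idx \<noteq> k" "prev_idx \<noteq> k" "next_idx \<noteq> prev_idx"
      and mods: "Suc k mod n = next_idx" "Suc prev_idx mod n = k"
      using k(1) vs(3) by (auto simp: next_idx_def prev_idx_def n_def)
    have mem: "vs ! i \<in> W" if "i < n" "i \<noteq> k" for i
    proof -
      have "vs ! i \<in> set vs" "vs ! i \<noteq> s"
        using that k vs(2) by (auto simp: n_def nth_eq_iff_index_eq)
      then show ?thesis using vs(1) by blast
    qed
    have "vs ! next_idx \<in> nbhd E s"
      using edges[of k] k mods by (simp add: nbhd_def n_def)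
    moreover have "vs ! prev_idx \<in> nbhd E s"
      using edges[of prev_idx] idx k mods by (simp add: nbhd_def n_def insert_commute)
    ultimately have "{vs ! next_idx, vs ! prev_idx} \<subseteq> nbhd E s \<inter> W"
      using mem idx by auto
    moreover have "vs ! next_idx \<noteq> vs ! prev_idx"
      using idx vs(2) by (simp add: n_def nth_eq_iff_index_eq)
    ultimately have "2 \<le> card (nbhd E s \<inter> W)"
      using card_mono[of "nbhd E s \<inter> W" "{vs ! next_idx, vs ! prev_idx}"] \<open>finite W\<close> by simp
    then show False using deg by simp
  qed
qed

section \<open>Removable vertex sets\<close>

lemma outerplanar_delete:
  assumes "simple_graph V E" "outerplanar V E"
  shows "simple_graph (V - S) (induced_edges E (V - S))" "outerplanar (V - S) (induced_edges E (V - S))"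
proof -
  obtain p \<gamma> where "outerplane_drawing V E p \<gamma>" using outerplanar_obtains_drawing assms by blast
  then interpret outerplane_drawing V E p \<gamma> .
  have "e \<subseteq> V - S \<and> card e = 2 \<and> (e \<in> E \<or> (\<exists>x\<in>V - (V - S). nbhd E x = e))"
    if "e \<in> induced_edges E (V - S)" for e
    using that assms(1) by (auto simp: induced_edges_def simple_graph_def)
  from outerplanar_suppress[OF Diff_subset this]
  show "simple_graph (V - S) (induced_edges E (V - S))" "outerplanar (V - S) (induced_edges E (V - S))"
    by blast+
qed

lemma nbhd_induced_edges:
  assumes "simple_graph V E" "x \<in> V - S"
  shows "nbhd (induced_edges E (V - S)) x = nbhd E x - S"
  using assms by (auto simp: nbhd_def induced_edges_def simple_graph_def)

text \<open>What remains outside \<open>S\<close> is outerplanar and so has a vertex of degree at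
  most 2, which is moved into \<open>S\<close>. Enlarging \<open>S\<close> never increases the
  number of neighbours outside it.\<close>

lemma outerplanar_peel:
  assumes simple: "simple_graph V E" and outer: "outerplanar V E" and "U \<subseteq> V" "card U + k \<le> card V"
  shows "\<exists>S. U \<subseteq> S \<and> S \<subseteq> V \<and> card S = card U + k \<and> (\<forall>s\<in>S - U. card (nbhd E s - S) \<le> 2)"
  using assms(4)
proof (induction k)
  case 0
  then show ?case using \<open>U \<subseteq> V\<close> by auto
next
  case (Suc k)
  then obtain S where S: "U \<subseteq> S" "S \<subseteq> V" "card S = card U + k" "\<forall>s\<in>S - U. card (nbhd E s - S) \<le> 2"
    by auto
  have fin: "finite V" "finite S" using simple S finite_subset by (auto simp: simple_graph_def)
  have "V - S \<noteq> {}" using S Suc.prems by auto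
  from outerplanar_light_edge[OF outerplanar_delete[OF simple outer] this]
  obtain x where x: "x \<in> V - S" "card (nbhd (induced_edges E (V - S)) x) \<le> 2" by fastforce
  then have "card (nbhd E x - S) \<le> 2" using nbhd_induced_edges[OF simple x(1)] by simp
  then have all: "card (nbhd E s - S) \<le> 2" if "s \<in> insert x S - U" for s
    using S(4) that by auto
  have "card (nbhd E s - insert x S) \<le> card (nbhd E s - S)" for s
    using finite_nbhd[OF simple] by (intro card_mono) auto
  then have "\<forall>s\<in>insert x S - U. card (nbhd E s - insert x S) \<le> 2"
    using all le_trans by blast
  moreover have "card (insert x S) = card U + Suc k" using x S fin by simp
  ultimately show ?case using S x by (intro exI[of _ "insert x S"]) auto
qed

text \<open>Peeling starts from a vertex \<open>x\<close> of degree at most 1, or else from a light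
  edge \<open>xy\<close>. In the second case the edge itself lies within \<open>S\<close>, which
  leaves \<open>x\<close> at most 1 and \<open>y\<close> at most 3 neighbours outside.\<close>

lemma outerplanar_removable_set:
  assumes simple: "simple_graph V E" and outer: "outerplanar V E" and t: "2 \<le> t" "t \<le> card V"
  shows "\<exists>S x. S \<subseteq> V \<and> card S = t \<and> x \<in> S \<and> card (nbhd E x - S) \<le> 1 \<and> (\<forall>s\<in>S. card (nbhd E s - S) \<le> 3)"
proof -
  have fin: "finite (nbhd E x)" for x using finite_nbhd[OF simple] .
  have "V \<noteq> {}" using t by auto
  from outerplanar_light_edge[OF simple outer this] obtain x where x: "x \<in> V"
    "card (nbhd E x) \<le> 1 \<or> card (nbhd E x) = 2 \<and> (\<exists>y\<in>nbhd E x. card (nbhd E y) \<le> 4)" by blast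
  then consider "card (nbhd E x) \<le> 1"
    | y where "card (nbhd E x) = 2" "y \<in> nbhd E x" "card (nbhd E y) \<le> 4" by blast
  then show ?thesis
  proof cases
    case 1
    obtain S where S: "{x} \<subseteq> S" "S \<subseteq> V" "card S = 1 + (t - 1)" "\<forall>s\<in>S - {x}. card (nbhd E s - S) \<le> 2"
      using outerplanar_peel[OF simple outer, of "{x}" "t - 1"] x(1) t by auto
    have "card (nbhd E x - S) \<le> 1"
      using 1 card_mono[OF fin, of "nbhd E x - S" x] by auto
    moreover have "card (nbhd E s - S) \<le> 3" if "s \<in> S" for s
    proof -
      have "s = x \<or> card (nbhd E s - S) \<le> 2" using S(4) that by blast
      then show ?thesis using calculation by auto
    qed
    ultimately show ?thesis using S t by (intro exI[of _ S] exI[of _ x]) auto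
  next
    case 2
    have y: "y \<in> V" "y \<noteq> x" using 2 nbhd_subset[OF simple] by blast+
    then have c2: "card {x, y} = 2" by auto
    have "{x, y} \<subseteq> V" "card {x, y} + (t - 2) \<le> card V" using x(1) y t c2 by auto
    from outerplanar_peel[OF simple outer this] obtain S where S: "{x, y} \<subseteq> S" "S \<subseteq> V"
      "card S = 2 + (t - 2)" "\<forall>s\<in>S - {x, y}. card (nbhd E s - S) \<le> 2"
      unfolding c2 by blast
    have "card (nbhd E x - S) \<le> card (nbhd E x - {y})"
      using S(1) fin by (intro card_mono) auto
    then have x1: "card (nbhd E x - S) \<le> 1" using 2 fin by simp
    have "x \<in> nbhd E y" using 2 nbhd_commute by metis
    have "card (nbhd E y - S) \<le> card (nbhd E y - {x})"
      using S(1) fin by (intro card_mono) auto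
    then have y3: "card (nbhd E y - S) \<le> 3" using 2 fin \<open>x \<in> nbhd E y\<close> by simp
    have "card (nbhd E s - S) \<le> 3" if "s \<in> S" for s
    proof -
      have "s = x \<or> s = y \<or> card (nbhd E s - S) \<le> 2" using S(4) that by blast
      then show ?thesis using x1 y3 by auto
    qed
    then show ?thesis using S t x1 by (intro exI[of _ S] exI[of _ x]) auto
  qed
qed

text \<open>A greedy choice that serves \<open>x\<close> last: while another element is waiting, at
  least two values remain and at most one of them is forbidden. The final value suits
  \<open>x\<close>, which forbids nothing.\<close>

lemma bij_betw_avoiding:
  assumes "finite S" "finite C" "card S = card C" "x \<in> S" "bad x = {}" "\<forall>s\<in>S. card (bad s \<inter> C) \<le> 1"
  shows "\<exists>b. bij_betw b S C \<and> (\<forall>s\<in>S. b s \<notin> bad s)"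
  using assms
proof (induction "card S" arbitrary: S C)
  case 0
  then show ?case by auto
next
  case (Suc n)
  show ?case
  proof (cases "S = {x}")
    case True
    then obtain c where "C = {c}" using Suc.prems by (metis card_1_singletonE card.empty card.insert finite.emptyI empty_iff One_nat_def)
    then show ?thesis using True Suc.prems by (intro exI[of _ "\<lambda>_. c"]) (auto simp: bij_betw_def)
  next
    case False
    then obtain s where s: "s \<in> S" "s \<noteq> x" using Suc.prems by blast
    have "card {x, s} \<le> card S" using s Suc.prems by (intro card_mono) auto
    then have "2 \<le> card C" using s Suc.prems by simp
    moreover have "card (bad s \<inter> C) \<le> 1" using Suc.prems s by blast
    ultimately have "\<not> C \<subseteq> bad s" by (metis Int_absorb1 le_trans not_less_eq_eq numeral_2_eq_2 One_nat_def)
    then obtain c where c: "c \<in> C" "c \<notin> bad s" by blast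
    have "\<exists>b. bij_betw b (S - {s}) (C - {c}) \<and> (\<forall>z\<in>S - {s}. b z \<notin> bad z)"
    proof (rule Suc.hyps(1))
      show "n = card (S - {s})" "card (S - {s}) = card (C - {c})" using Suc s c by auto
      show "\<forall>z\<in>S - {s}. card (bad z \<inter> (C - {c})) \<le> 1"
      proof
        fix z assume "z \<in> S - {s}"
        have "card (bad z \<inter> (C - {c})) \<le> card (bad z \<inter> C)" using Suc.prems by (intro card_mono) auto
        then show "card (bad z \<inter> (C - {c})) \<le> 1" using Suc.prems \<open>z \<in> S - {s}\<close> by fastforce
      qed
    qed (use Suc.prems s in auto)
    then obtain b where b: "bij_betw b (S - {s}) (C - {c})" "\<forall>z\<in>S - {s}. b z \<notin> bad z" by blast
    define b' where "b' = b(s := c)"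
    have "bij_betw b' (S - {s}) (C - {c})"
      using b(1) by (subst bij_betw_cong[of _ _ b]) (auto simp: b'_def)
    then have "bij_betw b' ((S - {s}) \<union> {s}) ((C - {c}) \<union> {b' s})"
      by (intro notIn_Un_bij_betw) (auto simp: b'_def)
    moreover have "(S - {s}) \<union> {s} = S" "(C - {c}) \<union> {b' s} = C" using s c by (auto simp: b'_def)
    ultimately have "bij_betw b' S C" by simp
    moreover have "\<forall>z\<in>S. b' z \<notin> bad z" using b(2) c by (auto simp: b'_def)
    ultimately show ?thesis by blast
  qed
qed

text \<open>Every class gains exactly one vertex of \<open>S\<close>, so differences of class sizes
  are unchanged, and the new vertex has at most one neighbour in its class.\<close>

lemma equitable_tree_coloring_extend:
  assumes simple: "simple_graph V E" and S: "S \<subseteq> V" "card S = t" "x \<in> S" "card (nbhd E x - S) \<le> 1"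
    "\<forall>s\<in>S. card (nbhd E s - S) \<le> 3"
    and f: "equitable_tree_coloring (V - S) (induced_edges E (V - S)) t f"
  shows "\<exists>g. equitable_tree_coloring V E t g"
proof -
  have fin: "finite V" "finite S" using simple S finite_subset by (auto simp: simple_graph_def)
  have finN: "finite {u \<in> nbhd E s - S. f u = c}" for s c using finite_nbhd[OF simple] by simp
  \<comment> \<open>The colors that would give \<open>s\<close> two neighbours in its own class;
    vertices of \<open>S\<close> do not count, as they receive pairwise different colors.\<close>
  define bad where "bad s = {c. 2 \<le> card {u \<in> nbhd E s - S. f u = c}}" for s
  have "bad x = {}"
  proof -
    have "card {u \<in> nbhd E x - S. f u = c} \<le> card (nbhd E x - S)" for c
      using finite_nbhd[OF simple] by (intro card_mono) auto
    then have "card {u \<in> nbhd E x - S. f u = c} \<le> 1" for c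
      using S(4) le_trans by blast
    then show ?thesis unfolding bad_def by (auto simp: not_le le_less_trans[of _ 1])
  qed
  moreover have "\<forall>s\<in>S. card (bad s \<inter> {1..t}) \<le> 1"
  proof (rule ccontr)
    assume "\<not> ?thesis"
    then obtain s where s: "s \<in> S" "2 \<le> card (bad s \<inter> {1..t})" by fastforce
    then obtain A where A: "A \<subseteq> bad s \<inter> {1..t}" "card A = 2" by (meson obtain_subset_with_card_n)
    then obtain c d where cd: "c \<in> bad s" "d \<in> bad s" "c \<noteq> d" by (auto simp: card_2_iff)
    \<comment> \<open>Two bad colors would require four neighbours outside \<open>S\<close>.\<close>
    have "4 \<le> card {u \<in> nbhd E s - S. f u = c} + card {u \<in> nbhd E s - S. f u = d}"
      using cd by (auto simp: bad_def)
    also have "\<dots> = card ({u \<in> nbhd E s - S. f u = c} \<union> {u \<in> nbhd E s - S. f u = d})"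
      using cd(3) finN by (subst card_Un_disjoint) auto
    also have "\<dots> \<le> card (nbhd E s - S)"
      using finite_nbhd[OF simple] by (intro card_mono) auto
    finally show False using S(5) s(1) by fastforce
  qed
  ultimately obtain b where b: "bij_betw b S {1..t}" "\<forall>s\<in>S. b s \<notin> bad s"
    using bij_betw_avoiding[of S "{1..t}" x bad] fin S(2,3) by auto
  define g where "g v = (if v \<in> S then b v else f v)" for v
  define D where "D i = color_class (V - S) f i" for i
  have finD: "finite (D i)" for i using fin by (simp add: D_def color_class_def)
  have class_g: "\<exists>s\<in>S. color_class V g i = insert s (D i) \<and> s \<notin> D i \<and> b s = i" if "i \<in> {1..t}" for i
  proof -
    have "i \<in> b ` S" using b(1) that by (simp add: bij_betw_def)
    then obtain s where s: "s \<in> S" "b s = i" by blast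
    have "b v = i \<longleftrightarrow> v = s" if "v \<in> S" for v
      using b(1) s that unfolding bij_betw_def by (metis inj_onD)
    then have "v \<in> V \<and> g v = i \<longleftrightarrow> v = s \<or> v \<in> V - S \<and> f v = i" for v
      using s(1) S(1) by (cases "v \<in> S") (auto simp: g_def)
    then have "color_class V g i = insert s (D i)" "s \<notin> D i"
      using s(1) unfolding color_class_def D_def by auto
    then show ?thesis using s by blast
  qed
  have card_g: "card (color_class V g i) = Suc (card (D i))" if "i \<in> {1..t}" for i
    using class_g[OF that] finD by auto
  have "coloring V t g"
    using f b(1) unfolding equitable_tree_coloring_def coloring_def g_def by (auto simp: bij_betw_def)
  moreover have "equitable V t g"
    using f unfolding equitable_tree_coloring_def equitable_def by (simp add: card_g D_def[symmetric])
  moreover have "forest (color_class V g i) (induced_edges E (color_class V g i))" if "i \<in> {1..t}" for i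
  proof -
    obtain s where s: "s \<in> S" "color_class V g i = insert s (D i)" "b s = i"
      using class_g[OF \<open>i \<in> {1..t}\<close>] by blast
    have "induced_edges (induced_edges E (V - S)) (D i) = induced_edges E (D i)"
      by (auto simp: induced_edges_def D_def color_class_def)
    then have "forest (D i) (induced_edges E (D i))"
      using f that unfolding equitable_tree_coloring_def D_def by metis
    moreover have "card (nbhd E s \<inter> D i) \<le> 1"
    proof -
      have "card (nbhd E s \<inter> D i) \<le> card {u \<in> nbhd E s - S. f u = i}"
        using finN by (intro card_mono) (auto simp: D_def color_class_def)
      moreover have "\<not> 2 \<le> card {u \<in> nbhd E s - S. f u = i}" using b(2) s by (auto simp: bad_def)
      ultimately show ?thesis by linarith
    qed
    ultimately show ?thesis using forest_insert finD s(2) by metis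
  qed
  ultimately show ?thesis unfolding equitable_tree_coloring_def by blast
qed

section \<open>Induction on the number of vertices, and the smallest number of colors\<close>

lemma equitable_tree_coloring_small:
  assumes "finite V" "card V \<le> t"
  shows "\<exists>f. equitable_tree_coloring V E t f"
proof -
  obtain f where f: "f ` V \<subseteq> {1..t}" "inj_on f V"
    using card_le_inj[of V "{1..t}"] assms by auto
  have class_le_1: "card (color_class V f i) \<le> 1" for i
    using f(2) by (auto simp: card_le_Suc0_iff_eq assms(1) color_class_def inj_on_def)
  have "forest (color_class V f i) F" for i F
  proof (rule card_le_2_imp_forest)
    show "finite (color_class V f i)" using assms(1) by (simp add: color_class_def)
    show "card (color_class V f i) \<le> 2" using class_le_1[of i] by simp
  qed
  moreover have "\<bar>int (card (color_class V f i)) - int (card (color_class V f j))\<bar> \<le> 1" for i j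
    using class_le_1[of i] class_le_1[of j] by linarith
  ultimately have "equitable_tree_coloring V E t f"
    using f(1) unfolding equitable_tree_coloring_def coloring_def equitable_def by simp
  then show ?thesis by blast
qed

lemma outerplanar_equitable_tree_coloring:
  assumes "simple_graph V E" "outerplanar V E" "2 \<le> t"
  shows "\<exists>f. equitable_tree_coloring V E t f"
  using assms(1,2)
proof (induction "card V" arbitrary: V E rule: less_induct)
  case less
  have fin: "finite V" using less.prems by (simp add: simple_graph_def)
  show ?case
  proof (cases "card V \<le> t")
    case True
    then show ?thesis using equitable_tree_coloring_small fin by blast
  next
    case False
    then obtain S x where S: "S \<subseteq> V" "card S = t" "x \<in> S" "card (nbhd E x - S) \<le> 1"
      "\<forall>s\<in>S. card (nbhd E s - S) \<le> 3"
      using outerplanar_removable_set[OF less.prems \<open>2 \<le> t\<close>] by auto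
    have "card (V - S) < card V"
      using S fin False \<open>2 \<le> t\<close> finite_subset[OF S(1)] by (subst card_Diff_subset) auto
    then obtain f where "equitable_tree_coloring (V - S) (induced_edges E (V - S)) t f"
      using less.hyps outerplanar_delete[OF less.prems] by blast
    then show ?thesis using equitable_tree_coloring_extend[OF less.prems(1) S] by blast
  qed
qed

text \<open>With one color the only class is \<open>V\<close> itself.\<close>

lemma equitable_tree_coloring_one_iff:
  assumes "simple_graph V E"
  shows "(\<exists>f. equitable_tree_coloring V E 1 f) \<longleftrightarrow> forest V E"
proof -
  have E: "induced_edges E V = E" using assms by (auto simp: induced_edges_def simple_graph_def)
  show ?thesis
  proof
    assume "\<exists>f. equitable_tree_coloring V E 1 f"
    then obtain f where f: "f ` V \<subseteq> {1}" "forest (color_class V f 1) (induced_edges E (color_class V f 1))"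
      by (auto simp: equitable_tree_coloring_def coloring_def)
    then have "color_class V f 1 = V" by (auto simp: color_class_def)
    then show "forest V E" using f E by simp
  next
    assume "forest V E"
    moreover have "color_class V (\<lambda>_. 1) 1 = V" by (auto simp: color_class_def)
    ultimately have "equitable_tree_coloring V E 1 (\<lambda>_. 1)"
      using E by (auto simp: equitable_tree_coloring_def coloring_def equitable_def)
    then show "\<exists>f. equitable_tree_coloring V E 1 f" by blast
  qed
qed

theorem theorem3p10:
  fixes V :: "'a set" and E :: "'a set set"
  assumes "simple_graph V E" and "outerplanar V E"
  shows "(\<forall>t\<ge>2. \<exists>f. equitable_tree_coloring V E t f) \<and>
         va_equiv V E = (if forest V E then 1 else 2)"
proof
  show ge_2: "\<forall>t\<ge>2. \<exists>f. equitable_tree_coloring V E t f"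
    using outerplanar_equitable_tree_coloring assms by blast
  have one: "(\<forall>t\<ge>1. \<exists>f. equitable_tree_coloring V E t f) \<longleftrightarrow> forest V E"
  proof
    assume "forest V E"
    then have "\<exists>f. equitable_tree_coloring V E 1 f"
      using equitable_tree_coloring_one_iff[OF assms(1)] by simp
    then show "\<forall>t\<ge>1. \<exists>f. equitable_tree_coloring V E t f"
      using ge_2 by (metis One_nat_def Suc_leI le_neq_implies_less numeral_2_eq_2)
  qed (use equitable_tree_coloring_one_iff[OF assms(1)] in blast)
  let ?m = "if forest V E then 1 else (2::nat)"
  show "va_equiv V E = ?m"
    unfolding va_equiv_def
  proof (rule Least_equality)
    show "1 \<le> ?m \<and> (\<forall>t\<ge>?m. \<exists>f. equitable_tree_coloring V E t f)"
      using one ge_2 by simp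
    fix t :: nat assume t: "1 \<le> t \<and> (\<forall>t'\<ge>t. \<exists>f. equitable_tree_coloring V E t' f)"
    \<comment> \<open>If \<open>t = 1\<close> has the property, then the graph is a forest and
      \<open>?m\<close> is 1. Otherwise \<open>t\<close> is at least 2.\<close>
    show "?m \<le> t"
    proof (cases "t = 1")
      case True
      then show ?thesis using t one by simp
    qed (use t in auto)
  qed
qed

end
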